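(* Let $G$ be a bridgeless planar ribbon graph with planar dual ribbon graph $G^\star$. Let $\beta$ and $\beta^\star$ denote the canonical Bernardi actions of $\operatorname{Pic}^0(G)$ on $S(G)$ and of $\operatorname{Pic}^0(G^\star)$ on $S(G^\star)$, respectively. Then for all $\gamma \in \operatorname{Pic}^0(G)$ and $T \in S(G)$, \[ \sigma(\beta(\gamma, T)) = \beta^\star(\Psi(\gamma), \sigma(T)), \] i.e. the diagram with rows $\beta : \operatorname{Pic}^0(G) \times S(G) \to S(G)$ and $\beta^\star : \operatorname{Pic}^0(G^\star)\times S(G^\star) \to S(G^\star)$ and vertical maps $\Psi \times \sigma$ and $\sigma$ commutes.
   Context: A graph means a finite connected multigraph without loop edges; a ribbon graph is a graph with a cyclic ordering of the edges around each vertex. $G$ is a planar ribbon graph if it is embedded in $\mathbb{R}^2$ without crossings with cyclic orderings induced by the counterclockwise orientation. A bridge is an edge whose removal disconnects the graph. The planar dual $G^\star$ has a vertex for each face of the embedding and an edge $e^\star$ crossing each edge $e$ of $G$; its ribbon structure is the one induced by the opposite (clockwise) orientation of the plane. $S(G)$ is the set of spanning trees; $\sigma : S(G) \to S(G^\star)$ sends $T$ to the spanning tree whose edges are the duals of the edges of $G$ not in $T$. Divisors, $\Delta f = \sum_u \big(\sum_{\text{edges } uw}(f(u)-f(w))\big)(u)$, linear equivalence ($D\sim D'$ iff $D-D'=\Delta f$), and $\operatorname{Pic}^d$ (classes of degree-$d$ divisors) are as usual; $\operatorname{Pic}^0$ is a group. Directed edges of $G$ are identified with directed edges of $G^\star$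 by orienting $e^\star$ from the orientation of $e$ by following the orientation of the plane locally at the crossing; this gives an isomorphism $c \mapsto c^\star$ between integral $1$-chains on $G$ and on $G^\star$. With $\partial$ the boundary map from $1$-chains to degree-$0$ divisors (a directed edge $(x,y)$ maps to $(y)-(x)$), every class in $\operatorname{Pic}^0(G)$ is $[\partial c]$ for some integral $1$-chain $c$, and $\Psi : \operatorname{Pic}^0(G) \to \operatorname{Pic}^0(G^\star)$, $[\partial c] \mapsto [\partial c^\star]$, is a well-defined isomorphism. Genus $g = |E|-|V|+1$. For a spanning tree $T$ with non-tree edges $e_1,\dots,e_g$, a $T$-break divisor is $\sum_i(v_i)$ with $v_i$ an endpoint of $e_i$; $B(G)$ is the set of all such. Every class of $\operatorname{Pic}^g(G)$ contains a unique element of $B(G)$; $\gamma \cdot D :=$ the break divisor linearly equivalent to $D+\gamma$. Bernardi map: for a vertex $v$, an edge $e$ at $v$, and a spanning tree $T$, the tour starts at $v$ examining edges at $v$ in cyclic order starting with $e$; at current vertex $u$, an examined edge $f\notin T$ is cut through from $u$ and the next edge at $u$ examined, while $f \in T$ is walked along to its other endpoint $u'$, then edges at $u'$ are examined starting with the one after $f$; the tour ends when each tree edge is traversed in both directions. $\eta_{(v,e)}(f)$ is the endpoint from which $f\notin T$ is first cut through, and $\beta_{(v,e)}(T)=\sum_{f\notin T}(\eta_{(v,e)}(f))$, a bijection $S(G)\to B(G)$. The action $\beta_v$ is $\gamma\cdot T := \beta_{(v,e)}^{-1}(\gamma\cdot\beta_{(v,e)}(T))$; for planar ribbon graphs it is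 independent of $v$ and $e$, and this common action is $\beta$ (similarly $\beta^\star$ for $G^\star$). *)

theory Defs
  imports Main
begin

text \<open>Ribbon graphs as combinatorial maps. A ribbon graph is given by a finite set D of
darts (half-edges), a fixed-point-free involution a on D (pairing the two darts of each
edge) and a permutation r of D (r h is the next dart after h in the cyclic order at the
vertex of h). The dart h is the edge {h, a h} directed from vert r h to vert r (a h).
Vertices are the r-orbits of darts.\<close>

definition vert :: "('d \<Rightarrow> 'd) \<Rightarrow> 'd \<Rightarrow> 'd set" where
  "vert r h = {(r ^^ n) h | n. True}"

definition verts :: "'d set \<Rightarrow> ('d \<Rightarrow> 'd) \<Rightarrow> 'd set set" where
  "verts D r = vert r ` D"

definition edge_of :: "('d \<Rightarrow> 'd) \<Rightarrow> 'd \<Rightarrow> 'd set" where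
  "edge_of a h = {h, a h}"

definition edges :: "('d \<Rightarrow> 'd) \<Rightarrow> 'd set \<Rightarrow> 'd set set" where
  "edges a S = edge_of a ` S"

definition ribbon_graph :: "'d set \<Rightarrow> ('d \<Rightarrow> 'd) \<Rightarrow> ('d \<Rightarrow> 'd) \<Rightarrow> bool" where
  "ribbon_graph D a r \<longleftrightarrow> finite D \<and> bij_betw a D D \<and> (\<forall>h\<in>D. a (a h) = h \<and> a h \<noteq> h)
     \<and> bij_betw r D D"

text \<open>Adjacency of vertices using only the edges whose darts lie in S.\<close>
definition link :: "('d \<Rightarrow> 'd) \<Rightarrow> ('d \<Rightarrow> 'd) \<Rightarrow> 'd set \<Rightarrow> ('d set \<times> 'd set) set" where
  "link a r S = {(vert r h, vert r (a h)) | h. h \<in> S}"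

text \<open>The spanning subgraph with edge set S (given as an a-closed set of darts) is connected.\<close>
definition connected_via :: "'d set \<Rightarrow> ('d \<Rightarrow> 'd) \<Rightarrow> ('d \<Rightarrow> 'd) \<Rightarrow> 'd set \<Rightarrow> bool" where
  "connected_via D a r S \<longleftrightarrow> (\<forall>h\<in>D. \<forall>k\<in>D. (vert r h, vert r k) \<in> (link a r S)\<^sup>*)"

text \<open>A graph: finite, connected, no loop edges (nonempty edge set).\<close>
definition is_graph :: "'d set \<Rightarrow> ('d \<Rightarrow> 'd) \<Rightarrow> ('d \<Rightarrow> 'd) \<Rightarrow> bool" where
  "is_graph D a r \<longleftrightarrow> ribbon_graph D a r \<and> D \<noteq> {} \<and> connected_via D a r D
     \<and> (\<forall>h\<in>D. vert r h \<noteq> vert r (a h))"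

text \<open>Faces (with the convention that the face of h is the face to the right of h) are the
orbits of r o a; planarity = genus 0, i.e. Euler's formula V - E + F = 2.\<close>
definition planar_ribbon_graph :: "'d set \<Rightarrow> ('d \<Rightarrow> 'd) \<Rightarrow> ('d \<Rightarrow> 'd) \<Rightarrow> bool" where
  "planar_ribbon_graph D a r \<longleftrightarrow> is_graph D a r
     \<and> card (verts D r) + card (verts D (r \<circ> a)) = card (edges a D) + 2"

text \<open>Planar dual: same darts and same involution a; in the dual structure the dart h
sits at the face to the right of h (the (r o a)-orbit of h) and points to the face to the
left of h; the dual vertex rotation (clockwise order around each face) is r o a.\<close>
definition dual_rot :: "('d \<Rightarrow> 'd) \<Rightarrow> ('d \<Rightarrow> 'd) \<Rightarrow> ('d \<Rightarrow> 'd)" where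
  "dual_rot a r = r \<circ> a"

definition is_bridge :: "'d set \<Rightarrow> ('d \<Rightarrow> 'd) \<Rightarrow> ('d \<Rightarrow> 'd) \<Rightarrow> 'd \<Rightarrow> bool" where
  "is_bridge D a r h \<longleftrightarrow> h \<in> D \<and> \<not> connected_via D a r (D - edge_of a h)"

definition bridgeless :: "'d set \<Rightarrow> ('d \<Rightarrow> 'd) \<Rightarrow> ('d \<Rightarrow> 'd) \<Rightarrow> bool" where
  "bridgeless D a r \<longleftrightarrow> (\<forall>h\<in>D. \<not> is_bridge D a r h)"

text \<open>Spanning tree: a set of edges (as an a-closed set of darts) forming a connected,
acyclic spanning subgraph; acyclic = no edge of T has its endpoints joined in T minus it.\<close>
definition spanning_tree :: "'d set \<Rightarrow> ('d \<Rightarrow> 'd) \<Rightarrow> ('d \<Rightarrow> 'd) \<Rightarrow> 'd set \<Rightarrow> bool" where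
  "spanning_tree D a r T \<longleftrightarrow> T \<subseteq> D \<and> (\<forall>h\<in>T. a h \<in> T) \<and> connected_via D a r T
     \<and> (\<forall>h\<in>T. (vert r h, vert r (a h)) \<notin> (link a r (T - edge_of a h))\<^sup>*)"

text \<open>sigma T = the dual edges of the non-tree edges.\<close>
definition sigma :: "'d set \<Rightarrow> 'd set \<Rightarrow> 'd set" where
  "sigma D T = D - T"

text \<open>Bernardi tour: examining dart h at the current vertex; if h is not in T it is cut
through and the next dart r h is examined; if h is in T we walk to the other endpoint and
examine r (a h) next.\<close>
definition tour_step :: "('d \<Rightarrow> 'd) \<Rightarrow> ('d \<Rightarrow> 'd) \<Rightarrow> 'd set \<Rightarrow> 'd \<Rightarrow> 'd" where
  "tour_step a r T h = (if h \<in> T then r (a h) else r h)"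

definition first_visit :: "('d \<Rightarrow> 'd) \<Rightarrow> ('d \<Rightarrow> 'd) \<Rightarrow> 'd set \<Rightarrow> 'd \<Rightarrow> 'd \<Rightarrow> nat" where
  "first_visit a r T q h = (LEAST n. (tour_step a r T ^^ n) q = h)"

text \<open>Divisors are integer functions on vertices (vertices are sets of darts).
bernardi D a r q T = sum over non-tree edges f of (eta(f)), where the tour starts with
dart q (i.e. at vertex vert r q with edge edge_of a q); eta(f) = vert r h for the dart h
of f examined (cut) first.\<close>
definition bernardi :: "'d set \<Rightarrow> ('d \<Rightarrow> 'd) \<Rightarrow> ('d \<Rightarrow> 'd) \<Rightarrow> 'd \<Rightarrow> 'd set \<Rightarrow> 'd set \<Rightarrow> int" where
  "bernardi D a r q T = (\<lambda>x. int (card {h \<in> D - T.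
      first_visit a r T q h < first_visit a r T q (a h) \<and> vert r h = x}))"

definition break_divisors :: "'d set \<Rightarrow> ('d \<Rightarrow> 'd) \<Rightarrow> ('d \<Rightarrow> 'd) \<Rightarrow> ('d set \<Rightarrow> int) set" where
  "break_divisors D a r = {B. \<exists>T C. spanning_tree D a r T \<and> C \<subseteq> D - T
      \<and> (\<forall>h\<in>D - T. h \<in> C \<longleftrightarrow> a h \<notin> C)
      \<and> B = (\<lambda>x. int (card {h \<in> C. vert r h = x}))}"

definition laplacian :: "'d set \<Rightarrow> ('d \<Rightarrow> 'd) \<Rightarrow> ('d \<Rightarrow> 'd) \<Rightarrow> ('d set \<Rightarrow> int) \<Rightarrow> 'd set \<Rightarrow> int" where
  "laplacian D a r f = (\<lambda>x. \<Sum>h\<in>{h \<in> D. vert r h = x}. f (vert r h) - f (vert r (a h)))"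

definition lin_equiv :: "'d set \<Rightarrow> ('d \<Rightarrow> 'd) \<Rightarrow> ('d \<Rightarrow> 'd) \<Rightarrow> ('d set \<Rightarrow> int) \<Rightarrow> ('d set \<Rightarrow> int) \<Rightarrow> bool" where
  "lin_equiv D a r D1 D2 \<longleftrightarrow> (\<exists>f. \<forall>x. D1 x - D2 x = laplacian D a r f x)"

text \<open>gamma . Dv = the break divisor linearly equivalent to Dv + gamma (gamma of degree 0,
represented by any divisor in its class).\<close>
definition break_act :: "'d set \<Rightarrow> ('d \<Rightarrow> 'd) \<Rightarrow> ('d \<Rightarrow> 'd) \<Rightarrow> ('d set \<Rightarrow> int) \<Rightarrow> ('d set \<Rightarrow> int) \<Rightarrow> ('d set \<Rightarrow> int)" where
  "break_act D a r \<gamma> Dv = (THE B. B \<in> break_divisors D a r \<and> lin_equiv D a r B (\<lambda>x. Dv x + \<gamma> x))"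

definition bernardi_action :: "'d set \<Rightarrow> ('d \<Rightarrow> 'd) \<Rightarrow> ('d \<Rightarrow> 'd) \<Rightarrow> 'd \<Rightarrow> ('d set \<Rightarrow> int) \<Rightarrow> 'd set \<Rightarrow> 'd set" where
  "bernardi_action D a r q \<gamma> T = (THE T'. spanning_tree D a r T'
      \<and> bernardi D a r q T' = break_act D a r \<gamma> (bernardi D a r q T))"

text \<open>Boundary of an integral 1-chain c (coefficient c h on directed edge h).\<close>
definition boundary :: "'d set \<Rightarrow> ('d \<Rightarrow> 'd) \<Rightarrow> ('d \<Rightarrow> 'd) \<Rightarrow> ('d \<Rightarrow> int) \<Rightarrow> 'd set \<Rightarrow> int" where
  "boundary D a r c = (\<lambda>x. \<Sum>h\<in>D. c h * ((if vert r (a h) = x then 1 else 0) - (if vert r h = x then 1 else 0)))"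

text \<open>The chain isomorphism c \<mapsto> c*: the directed edge h of G (coefficient c h)
corresponds to the directed dual edge from the face left of h to the face right of h, which
is the dual dart a h. So c* assigns coefficient c (a h) to dual dart h.\<close>
definition dual_chain :: "('d \<Rightarrow> 'd) \<Rightarrow> ('d \<Rightarrow> int) \<Rightarrow> ('d \<Rightarrow> int)" where
  "dual_chain a c = c \<circ> a"

end

(* The Bernardi tour of T is also the tour of the complementary dual tree, and it orients G:
   tree edges away from the root, cut edges towards the endpoint from which they are first cut.
   Up to a constant depending only on the root, beta(T) is the indegree divisor of this orientation.
   Passing from T to T' reverses a set of edges, so beta(T') - beta(T) is the boundary of a chain c,
   and the dual difference is the boundary of c*.  Hence both actions match as soon as Psi is well
   defined (a cycle on G is a coboundary of a function on the faces) and the choice of the starting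
   dart does not matter (the class of beta(T') - beta(T) is unchanged when q moves around its vertex
   and, dually, around its face).

   That the actions are well defined follows from the same orientations.  Indegree divisors of two
   orientations in which every vertex is reachable from the root are equal once they are equivalent
   (compare them on the set where the function realising the equivalence is maximal); every class
   contains one, obtained by reversing directed cuts; and a greedy version of the tour finds the
   tree that belongs to such an orientation. *)

theory Submission
  imports Defs
begin

text \<open>A dart lies in the Bernardi orientation iff "it is a tree dart" and "it is visited
  before its partner" have the same truth value. Complementing \<open>T\<close> negates this, so
  with a common starting dart the dual orientation consists of the partners \<open>a h\<close>,
  which is how \<open>dual_chain\<close> acts. A common dart fixes a vertex and a face at once,
  while \<open>q\<close> and \<open>q'\<close> are unrelated. Moving \<open>q\<close> around its
  vertex changes every beta(T) by the same degree-0 divisor up to equivalence, so differences keep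
  their class. The starting darts for which the dual claim holds are thus closed under
  \<open>r\<close> (argued in the graph, transported to the dual) and under
  \<open>r \<circ> a\<close> (argued in the dual), and connectedness makes them all of
  \<open>D\<close>. The constant between beta and indegrees is one per vertex except the root: the
  number of tree arcs into it. Directed paths and cycles are kept as sets of arcs tested against
  integer functions on vertices: "zero net flow across every cut" stands for "union of cycles",
  which is why reachability from the root is stated as a cut condition.\<close>

locale ribbon_map =
  fixes D :: "'d set" and a r :: "'d \<Rightarrow> 'd"
  assumes ribbon: "ribbon_graph D a r"
begin

section \<open>Vertices as orbits, and a closure principle for darts\<close>

lemma finite_D [simp]: "finite D"
  and a_in [simp]: "h \<in> D \<Longrightarrow> a h \<in> D"
  and a_a [simp]: "h \<in> D \<Longrightarrow> a (a h) = h"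
  and a_neq [simp]: "h \<in> D \<Longrightarrow> a h \<noteq> h"
  and a_neq' [simp]: "h \<in> D \<Longrightarrow> h \<noteq> a h"
  and r_in [simp]: "h \<in> D \<Longrightarrow> r h \<in> D"
  using ribbon unfolding ribbon_graph_def bij_betw_def by fastforce+

lemma inj_r: "inj_on r D"
  using ribbon unfolding ribbon_graph_def bij_betw_def by blast

lemma funpow_in: "h \<in> D \<Longrightarrow> (r ^^ n) h \<in> D"
  by (induction n) auto

lemma self_in_vert [simp]: "h \<in> vert r h"
  unfolding vert_def by (rule CollectI, rule exI[of _ 0]) simp

lemma vert_subset: "h \<in> D \<Longrightarrow> vert r h \<subseteq> D"
  unfolding vert_def using funpow_in by auto

text \<open>\<open>vert\<close> collects only nonnegative powers of \<open>r\<close>. The orbit of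
  \<open>r h\<close> is the image of the orbit of \<open>h\<close> under the injective
  \<open>r\<close> and lies inside it; finite and of equal size, the two coincide.\<close>

lemma vert_r [simp]:
  assumes "h \<in> D"
  shows "vert r (r h) = vert r h"
proof -
  have shift: "(r ^^ n) (r h) = (r ^^ Suc n) h" for n
    by (simp add: funpow_swap1)
  have sub: "vert r (r h) \<subseteq> vert r h"
    unfolding vert_def shift by blast
  have eq: "vert r (r h) = r ` vert r h"
    unfolding vert_def shift by (auto simp: image_def)
  have fin: "finite (vert r h)"
    using vert_subset[OF assms] by (rule finite_subset) simp
  have "card (vert r (r h)) = card (vert r h)"
    unfolding eq by (rule card_image) (rule inj_on_subset[OF inj_r vert_subset[OF assms]])
  then show ?thesis
    using sub fin by (simp add: card_subset_eq)
qed

lemma vert_closed: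
  assumes "\<And>h. h \<in> W \<Longrightarrow> r h \<in> W" and "h \<in> W" and "vert r h = vert r k"
  shows "k \<in> W"
proof -
  have "k \<in> vert r h"
    using assms(3) by simp
  then obtain n where "k = (r ^^ n) h"
    unfolding vert_def by blast
  moreover have "(r ^^ n) h \<in> W" for n
    by (induction n) (use assms in auto)
  ultimately show ?thesis by simp
qed

text \<open>Closure under \<open>r\<close> makes \<open>W\<close> a union of vertices, so no path of
  links from \<open>S\<close> can leave it. This induction principle serves for orbits of the tour
  and, at the end, for changing the starting dart.\<close>

lemma closed_eq_D:
  assumes "connected_via D a r S" and "W \<subseteq> D" and "q \<in> W" and "S \<subseteq> D"
    and r: "\<And>h. h \<in> W \<Longrightarrow> r h \<in> W" and a: "\<And>h. h \<in> W \<Longrightarrow> h \<in> S \<Longrightarrow> a h \<in> W"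
  shows "W = D"
proof
  show "D \<subseteq> W"
  proof
    fix k assume k: "k \<in> D"
    then have "(vert r q, vert r k) \<in> (link a r S)\<^sup>*"
      using assms(1,2,3) unfolding connected_via_def by blast
    moreover have "\<exists>h\<in>W. vert r h = x" if "(vert r q, x) \<in> (link a r S)\<^sup>*" for x
      using that
    proof induction
      case base
      then show ?case using \<open>q \<in> W\<close> by blast
    next
      case (step y z)
      then obtain h g where "h \<in> W" "vert r h = y" "g \<in> S" "y = vert r g" "z = vert r (a g)"
        unfolding link_def by blast
      then have "g \<in> W"
        using vert_closed[of W h g] r by auto
      then show ?case
        using a \<open>g \<in> S\<close> \<open>z = vert r (a g)\<close> by blast
    qed
    ultimately obtain h where "h \<in> W" "vert r h = vert r k" by blast
    then show "k \<in> W"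
      using vert_closed r by blast
  qed
qed (fact assms(2))

lemma finite_verts [simp]: "finite (verts D r)"
  unfolding verts_def by simp

lemma vert_in_verts [simp]: "h \<in> D \<Longrightarrow> vert r h \<in> verts D r"
  unfolding verts_def by simp

lemma vertsE: "x \<in> verts D r \<Longrightarrow> (\<And>h. h \<in> D \<Longrightarrow> x = vert r h \<Longrightarrow> P) \<Longrightarrow> P"
  unfolding verts_def by blast

end

subsection \<open>Spanning trees and their cuts\<close>

locale connected_map = ribbon_map D a r
  for D :: "'d set" and a r :: "'d \<Rightarrow> 'd" +
  assumes connected: "connected_via D a r D"
begin

lemma link_sym:
  assumes "S \<subseteq> D" "\<And>h. h \<in> S \<Longrightarrow> a h \<in> S"
  shows "sym ((link a r S)\<^sup>*)"
proof (rule sym_rtrancl, rule symI)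
  fix x y assume "(x, y) \<in> link a r S"
  then obtain h where "h \<in> S" "x = vert r h" "y = vert r (a h)"
    unfolding link_def by blast
  then show "(y, x) \<in> link a r S"
    unfolding link_def using assms by force
qed

text \<open>The fundamental cut of a tree edge, with \<open>y\<close> pointing into
  \<open>A\<close>. Allowing any set \<open>A\<close>, not only sets of actual vertices, makes
  \<open>- A\<close> a cut for \<open>a y\<close>.\<close>

definition tree_cut :: "'d set \<Rightarrow> 'd \<Rightarrow> 'd set set \<Rightarrow> bool" where
  "tree_cut T y A \<longleftrightarrow> y \<in> T \<and> vert r y \<notin> A \<and> vert r (a y) \<in> A
     \<and> (\<forall>k\<in>T. k \<noteq> y \<longrightarrow> k \<noteq> a y \<longrightarrow> (vert r k \<in> A \<longleftrightarrow> vert r (a k) \<in> A))"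

definition tree_side :: "'d set \<Rightarrow> 'd \<Rightarrow> 'd set set" where
  "tree_side T y = {x. (vert r (a y), x) \<in> (link a r (T - edge_of a y))\<^sup>*}"

lemma spanning_treeD:
  assumes "spanning_tree D a r T"
  shows "T \<subseteq> D" "\<And>h. h \<in> T \<Longrightarrow> a h \<in> T" "connected_via D a r T"
    "\<And>h. h \<in> T \<Longrightarrow> h \<in> D" "\<And>h. h \<in> D \<Longrightarrow> a h \<in> T \<longleftrightarrow> h \<in> T"
    "\<And>h. h \<in> T \<Longrightarrow> (vert r h, vert r (a h)) \<notin> (link a r (T - edge_of a h))\<^sup>*"
proof -
  show sub: "T \<subseteq> D" and a: "\<And>h. h \<in> T \<Longrightarrow> a h \<in> T" and "connected_via D a r T"
    and "\<And>h. h \<in> T \<Longrightarrow> (vert r h, vert r (a h)) \<notin> (link a r (T - edge_of a h))\<^sup>*"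
    using assms unfolding spanning_tree_def by auto
  show "h \<in> D" if "h \<in> T" for h
    using sub that by blast
  show "a h \<in> T \<longleftrightarrow> h \<in> T" if "h \<in> D" for h
    using a[of h] a[of "a h"] a_a[OF that] by auto
qed

lemma remove_edge_closed:
  assumes "T \<subseteq> D" "\<And>h. h \<in> T \<Longrightarrow> a h \<in> T" "y \<in> D"
  shows "T - edge_of a y \<subseteq> D" "\<And>h. h \<in> T - edge_of a y \<Longrightarrow> a h \<in> T - edge_of a y"
proof -
  show "T - edge_of a y \<subseteq> D" using assms by blast
  fix h assume h: "h \<in> T - edge_of a y"
  then have "h \<in> D" using assms by blast
  then show "a h \<in> T - edge_of a y"
    using h assms(2)[of h] a_a[of h] a_a[of y] \<open>y \<in> D\<close> unfolding edge_of_def by (metis Diff_iff insert_iff empty_iff)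
qed

lemma tree_cut_tree_side:
  assumes T: "spanning_tree D a r T" and y: "y \<in> T"
  shows "tree_cut T y (tree_side T y)"
proof -
  note TD = spanning_treeD[OF T]
  let ?L = "link a r (T - edge_of a y)"
  have sym: "sym (?L\<^sup>*)"
    using remove_edge_closed[OF TD(1,2) TD(4)[OF y]] link_sym by blast
  have "vert r y \<notin> tree_side T y"
    using TD(6)[OF y] sym unfolding tree_side_def by (auto dest: symD)
  moreover have "vert r k \<in> tree_side T y \<longleftrightarrow> vert r (a k) \<in> tree_side T y"
    if "k \<in> T" "k \<noteq> y" "k \<noteq> a y" for k
  proof -
    have "(vert r k, vert r (a k)) \<in> ?L"
      using that unfolding link_def edge_of_def by blast
    then have "(vert r k, vert r (a k)) \<in> ?L\<^sup>*" by blast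
    then show ?thesis
      using sym unfolding tree_side_def by (auto dest: symD intro: rtrancl_trans)
  qed
  ultimately show ?thesis
    using y unfolding tree_cut_def tree_side_def by auto
qed

lemma tree_cut_uminus:
  assumes "T \<subseteq> D" "\<And>h. h \<in> T \<Longrightarrow> a h \<in> T" and "tree_cut T y A"
  shows "tree_cut T (a y) (- A)"
proof -
  have "y \<in> D" using assms unfolding tree_cut_def by auto
  then show ?thesis
    using assms(2,3) unfolding tree_cut_def by auto
qed

lemma tree_cut_cross:
  assumes "tree_cut T y A" and "k \<in> T" and "vert r k \<in> A" "vert r (a k) \<notin> A"
  shows "k = a y"
  using assms unfolding tree_cut_def by auto

subsection \<open>The tour of a spanning tree\<close>

context
  fixes T assumes T: "spanning_tree D a r T"
begin

lemmas TD = spanning_treeD[OF T]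

lemma tour_step_in: "h \<in> D \<Longrightarrow> tour_step a r T h \<in> D"
  unfolding tour_step_def by simp

lemma tour_in: "q \<in> D \<Longrightarrow> (tour_step a r T ^^ n) q \<in> D"
  by (induction n) (auto simp: tour_step_in)

text \<open>The step is \<open>r\<close> after the involution \<open>b\<close> that swaps the two
  darts of each tree edge and fixes all other darts.\<close>

lemma inj_tour_step: "inj_on (tour_step a r T) D"
proof (rule inj_onI)
  fix h k assume hk: "h \<in> D" "k \<in> D" and eq: "tour_step a r T h = tour_step a r T k"
  define b where "b h = (if h \<in> T then a h else h)" for h
  have "r (b h) = r (b k)" "b h \<in> D" "b k \<in> D"
    using eq hk unfolding tour_step_def b_def by auto
  then have b: "b h = b k"
    by (rule inj_onD[OF inj_r])
  have "b (b h) = h" "b (b k) = k"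
    using hk TD(5) unfolding b_def by auto
  then show "h = k"
    using b by metis
qed

text \<open>Cutting through stays at the vertex, and the edge of \<open>y\<close> is the only tree
  edge across the cut. So the tour enters \<open>A\<close> only along \<open>y\<close> and leaves it
  only along \<open>a y\<close>.\<close>

lemma tree_cut_step:
  assumes "tree_cut T y A" "h \<in> D"
  shows "vert r (tour_step a r T h) \<in> A \<longleftrightarrow> h = y \<or> h \<noteq> a y \<and> vert r h \<in> A"
proof (cases "h \<in> T")
  case True
  then show ?thesis
    using assms TD(4) unfolding tree_cut_def tour_step_def by auto
next
  case False
  then show ?thesis
    using assms TD(2) unfolding tree_cut_def tour_step_def by auto
qed

text \<open>Without \<open>a y\<close>, the tour could never leave the part \<open>?X\<close> of
  \<open>W\<close> beyond \<open>y\<close>. Injectivity would make the step a permutation of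
  \<open>?X\<close>, yet walking along \<open>y\<close> enters \<open>?X\<close> from
  outside.\<close>

lemma tour_orbit_closed:
  assumes W: "W \<subseteq> D" "\<And>h. h \<in> W \<Longrightarrow> tour_step a r T h \<in> W" and "y \<in> W" "y \<in> T"
  shows "a y \<in> W"
proof (rule ccontr)
  assume ay: "a y \<notin> W"
  let ?A = "tree_side T y" and ?t = "tour_step a r T"
  let ?X = "{h \<in> W. vert r h \<in> ?A}"
  note cut = tree_cut_tree_side[OF T \<open>y \<in> T\<close>]
  have X: "?X \<subseteq> D" using W by auto
  have y: "y \<notin> ?X" using cut unfolding tree_cut_def by auto
  have "?t ` ?X \<subseteq> ?X"
    using W ay tree_cut_step[OF cut] by fastforce
  moreover have "finite ?X" using X by (rule finite_subset) simp
  moreover have "inj_on ?t ?X" using inj_tour_step X by (rule inj_on_subset)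
  ultimately have "?t ` ?X = ?X" by (simp add: endo_inj_surj)
  moreover have "?t y \<in> ?X" using W \<open>y \<in> W\<close> tree_cut_step[OF cut] by auto
  ultimately obtain x where "x \<in> ?X" "?t x = ?t y" by (metis (no_types, lifting) imageE)
  moreover have "y \<in> D" "x \<in> D" using \<open>y \<in> W\<close> W \<open>x \<in> ?X\<close> by auto
  ultimately have "x = y" using inj_onD[OF inj_tour_step] by blast
  then show False using \<open>x \<in> ?X\<close> y by simp
qed

text \<open>Once \<open>a h\<close> is available for tree darts, \<open>r h\<close> is the successor
  of \<open>a h\<close> if \<open>h\<close> is in \<open>T\<close> and of \<open>h\<close>
  otherwise. So the closure principle applies: the tour is one cycle through all darts.\<close>

lemma tour_single_orbit:
  assumes W: "W \<subseteq> D" "\<And>h. h \<in> W \<Longrightarrow> tour_step a r T h \<in> W" and "q \<in> W"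
  shows "W = D"
proof (rule closed_eq_D[OF TD(3) W(1) \<open>q \<in> W\<close> TD(1)])
  show a: "a h \<in> W" if "h \<in> W" "h \<in> T" for h
    using tour_orbit_closed[OF W] that by blast
  show "r h \<in> W" if "h \<in> W" for h
  proof (cases "h \<in> T")
    case True
    then show ?thesis
      using W(2)[OF a[OF that True]] TD(2,4) unfolding tour_step_def by simp
  next
    case False
    then show ?thesis
      using W(2)[OF that] unfolding tour_step_def by simp
  qed
qed

lemma tour_reaches:
  assumes "q \<in> D" "h \<in> D"
  shows "\<exists>n. (tour_step a r T ^^ n) q = h"
proof -
  define W where "W = {k. \<exists>n. (tour_step a r T ^^ n) q = k}"
  have "q \<in> W"
    unfolding W_def by (rule CollectI, rule exI[of _ 0], rule funpow_0)
  moreover have "W \<subseteq> D"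
    using tour_in[OF assms(1)] unfolding W_def by blast
  moreover have "tour_step a r T k \<in> W" if k: "k \<in> W" for k
  proof -
    obtain n where "(tour_step a r T ^^ n) q = k" using k unfolding W_def by blast
    then have "(tour_step a r T ^^ Suc n) q = tour_step a r T k" by simp
    then show ?thesis unfolding W_def by blast
  qed
  ultimately have "W = D"
    using tour_single_orbit[of W q] by blast
  then show ?thesis using assms(2) unfolding W_def by blast
qed

abbreviation "fv \<equiv> first_visit a r T"

lemma tour_fv: "q \<in> D \<Longrightarrow> h \<in> D \<Longrightarrow> (tour_step a r T ^^ fv q h) q = h"
  unfolding first_visit_def using LeastI_ex[OF tour_reaches] .

lemma fv_le: "(tour_step a r T ^^ n) q = h \<Longrightarrow> fv q h \<le> n"
  unfolding first_visit_def by (rule Least_le)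

lemma fv_eq_iff:
  assumes "q \<in> D" "h \<in> D" "k \<in> D"
  shows "fv q h = fv q k \<longleftrightarrow> h = k"
proof
  assume eq: "fv q h = fv q k"
  show "h = k"
    using tour_fv[OF assms(1,2)] unfolding eq tour_fv[OF assms(1,3)] by (rule sym)
qed simp

lemma fv_start [simp]: "fv q q = 0"
  using fv_le[of 0 q q] by simp

lemma fv_step:
  assumes q: "q \<in> D" and h: "h \<in> D" and "tour_step a r T h \<noteq> q"
  shows "fv q (tour_step a r T h) = Suc (fv q h)"
proof (rule antisym)
  show "fv q (tour_step a r T h) \<le> Suc (fv q h)"
    by (rule fv_le) (simp add: tour_fv q h)
  have "fv q (tour_step a r T h) \<noteq> 0"
    using tour_fv[OF q tour_step_in[OF h]] assms(3) by (intro notI) simp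
  then obtain m where m: "fv q (tour_step a r T h) = Suc m"
    using not0_implies_Suc by blast
  then have "tour_step a r T ((tour_step a r T ^^ m) q) = tour_step a r T h"
    using tour_fv[OF q tour_step_in[OF h]] by simp
  then have "(tour_step a r T ^^ m) q = h"
    using inj_onD[OF inj_tour_step] tour_in[OF q] h by blast
  then show "Suc (fv q h) \<le> fv q (tour_step a r T h)"
    using fv_le[of m q h] m by simp
qed

lemma fv_pred:
  assumes q: "q \<in> D" and h: "h \<in> D" and "h \<noteq> q"
  obtains p where "p \<in> D" "h = tour_step a r T p" "fv q h = Suc (fv q p)"
proof -
  have "fv q h \<noteq> 0"
  proof
    assume 0: "fv q h = 0"
    have "q = h" using tour_fv[OF q h] unfolding 0 funpow_0 .
    then show False using assms(3) by simp
  qed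
  then obtain m where m: "fv q h = Suc m"
    using not0_implies_Suc by blast
  let ?p = "(tour_step a r T ^^ m) q"
  have h_eq: "h = tour_step a r T ?p"
    using tour_fv[OF q h] m by simp
  have "?p \<in> D" using tour_in[OF q] .
  moreover have "fv q h = Suc (fv q ?p)"
    using fv_step[OF q \<open>?p \<in> D\<close>] h_eq assms(3) by simp
  ultimately show thesis using that h_eq by blast
qed

text \<open>A return to \<open>q\<close> on the way to \<open>h\<close> could be skipped, reaching
  \<open>h\<close> before its first visit.\<close>

lemma fv_funpow:
  assumes q: "q \<in> D" and h: "h \<in> D" and "m \<le> fv q h"
  shows "fv q ((tour_step a r T ^^ m) q) = m"
  using assms(3)
proof (induction m)
  case (Suc m)
  have "tour_step a r T ((tour_step a r T ^^ m) q) \<noteq> q"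
  proof
    assume "tour_step a r T ((tour_step a r T ^^ m) q) = q"
    then have "(tour_step a r T ^^ Suc m) q = q" by simp
    moreover have "(tour_step a r T ^^ (fv q h - Suc m)) ((tour_step a r T ^^ Suc m) q) = h"
      using tour_fv[OF q h] Suc.prems funpow_add[of "fv q h - Suc m" "Suc m" "tour_step a r T"] by simp
    ultimately have "fv q h \<le> fv q h - Suc m"
      by (intro fv_le) simp
    then show False using Suc.prems by simp
  qed
  then show ?case
    using fv_step[OF q tour_in[OF q]] Suc by simp
qed simp

lemma fv_image:
  assumes q: "q \<in> D"
  shows "fv q ` D = {..<card D}"
proof -
  have inj: "inj_on (fv q) D"
    using fv_eq_iff[OF q] by (simp add: inj_on_def)
  have down: "m \<in> fv q ` D" if "h \<in> D" "m \<le> fv q h" for m h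
    using fv_funpow[OF q that] tour_in[OF q] by (metis image_eqI)
  have lt: "fv q h < card D" if "h \<in> D" for h
  proof -
    have "{..fv q h} \<subseteq> fv q ` D" using down that by auto
    then have "card {..fv q h} \<le> card (fv q ` D)" by (intro card_mono) auto
    then show ?thesis using card_image[OF inj] by simp
  qed
  show ?thesis
  proof (rule card_subset_eq)
    show "fv q ` D \<subseteq> {..<card D}" using lt by auto
  qed (use card_image[OF inj] in auto)
qed

text \<open>The tour starts outside \<open>A\<close>, enters only after \<open>y\<close>, leaves
  only after \<open>a y\<close>, and meets each dart once. Hence the darts at \<open>A\<close> form
  one block, opened right after \<open>y\<close> and closed by \<open>a y\<close>. Most later
  comparisons of visiting times rest on this.\<close>

lemma tree_cut_interval:
  assumes q: "q \<in> D" "vert r q \<notin> A" and cut: "tree_cut T y A" and h: "h \<in> D"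
  shows "vert r h \<in> A \<longleftrightarrow> fv q y < fv q h \<and> fv q h \<le> fv q (a y)"
proof -
  have y: "y \<in> T" "y \<in> D" "a y \<in> D" "vert r y \<notin> A" "vert r (a y) \<in> A"
    using cut TD(4) unfolding tree_cut_def by auto
  have after: "fv q y < fv q k" if "k \<in> D" "vert r k \<in> A" for k
    using that
  proof (induction "fv q k" arbitrary: k rule: less_induct)
    case less
    then have "k \<noteq> q" using q by auto
    then obtain p where p: "p \<in> D" "k = tour_step a r T p" "fv q k = Suc (fv q p)"
      using fv_pred q less.prems by metis
    then show ?case
      using less.prems less.hyps[of p] tree_cut_step[OF cut p(1)] by (cases "p = y") auto
  qed
  have before: "fv q k \<le> fv q (a y)" if "k \<in> D" "vert r k \<in> A" for k
    using that
  proof (induction "fv q k" arbitrary: k rule: less_induct)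
    case less
    then have "k \<noteq> q" using q by auto
    then obtain p where p: "p \<in> D" "k = tour_step a r T p" "fv q k = Suc (fv q p)"
      using fv_pred q less.prems by metis
    show ?case
    proof (cases "p = y")
      case True
      then show ?thesis using p after[of "a y"] y by simp
    next
      case False
      then have "p \<noteq> a y" "vert r p \<in> A"
        using p less.prems tree_cut_step[OF cut p(1)] by auto
      then have "fv q p \<le> fv q (a y)" "fv q p \<noteq> fv q (a y)"
        using less.hyps[of p] p fv_eq_iff q y by auto
      then show ?thesis using p by simp
    qed
  qed
  have outside: "fv q (a y) < fv q k" if "k \<in> D" "vert r k \<notin> A" "fv q y < fv q k" for k
    using that
  proof (induction "fv q k" arbitrary: k rule: less_induct)
    case less
    then have "k \<noteq> q" by auto
    then obtain p where p: "p \<in> D" "k = tour_step a r T p" "fv q k = Suc (fv q p)"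
      using fv_pred q less.prems by metis
    have "p \<noteq> y" using p less.prems tree_cut_step[OF cut p(1)] by auto
    then have "fv q y < fv q p"
      using p less.prems fv_eq_iff[OF q(1) p(1) y(2)] by linarith
    show ?case
    proof (cases "vert r p \<in> A")
      case True
      then have "p = a y" using p less.prems tree_cut_step[OF cut p(1)] by auto
      then show ?thesis using p by simp
    next
      case False
      then show ?thesis using less.hyps[of p] p \<open>fv q y < fv q p\<close> by simp
    qed
  qed
  show ?thesis
    using after[OF h] before[OF h] outside[OF h] by fastforce
qed

text \<open>A root inside \<open>A\<close> is handled by the complementary cut, where
  \<open>a y\<close> takes the place of \<open>y\<close>.\<close>

lemma tree_cut_first:
  assumes q: "q \<in> D" and cut: "tree_cut T y A"
  shows "vert r q \<notin> A \<longleftrightarrow> fv q y < fv q (a y)"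
proof -
  have y: "y \<in> T" "y \<in> D" "vert r (a y) \<in> A" "vert r y \<notin> A"
    using cut TD(4) unfolding tree_cut_def by auto
  have cut': "tree_cut T (a y) (- A)"
    by (rule tree_cut_uminus[OF TD(1,2) cut])
  show ?thesis
    using tree_cut_interval[OF q _ cut, of "a y"] tree_cut_interval[OF q _ cut', of y] y by auto
qed

end

subsection \<open>Orientations and their indegree divisors\<close>

definition orientation :: "'d set \<Rightarrow> bool" where
  "orientation X \<longleftrightarrow> X \<subseteq> D \<and> (\<forall>h\<in>D. h \<in> X \<longleftrightarrow> a h \<notin> X)"

definition heads :: "'d set \<Rightarrow> 'd set \<Rightarrow> int" where
  "heads X x = (\<Sum>h\<in>X. of_bool (vert r (a h) = x))"

text \<open>Cut form of "every vertex is reachable from \<open>x\<close> along arcs of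
  \<open>X\<close>" (see \<open>reach_rooted\<close> and \<open>rooted_reach\<close>); it suits
  arguments that count arcs across \<open>A\<close>.\<close>

definition rooted :: "'d set \<Rightarrow> 'd set \<Rightarrow> bool" where
  "rooted X x \<longleftrightarrow> (\<forall>A. x \<notin> A \<longrightarrow> (\<exists>h\<in>D. vert r h \<in> A) \<longrightarrow> (\<exists>k\<in>X. vert r k \<notin> A \<and> vert r (a k) \<in> A))"

lemma orientationD:
  assumes "orientation X"
  shows "X \<subseteq> D" "finite X" "\<And>h. h \<in> X \<Longrightarrow> h \<in> D" "\<And>h. h \<in> D \<Longrightarrow> a h \<in> X \<longleftrightarrow> h \<notin> X"
proof -
  show X: "X \<subseteq> D" using assms unfolding orientation_def by blast
  show "finite X" using X by (rule finite_subset) simp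
  show "\<And>h. h \<in> X \<Longrightarrow> h \<in> D" using X by blast
  show "\<And>h. h \<in> D \<Longrightarrow> a h \<in> X \<longleftrightarrow> h \<notin> X" using assms unfolding orientation_def by blast
qed

lemma rootedE:
  assumes "rooted X x" "x \<notin> A" "h \<in> D" "vert r h \<in> A"
  obtains k where "k \<in> X" "vert r k \<notin> A" "vert r (a k) \<in> A"
  using assms unfolding rooted_def by blast

lemma sum_heads:
  fixes g :: "'d set \<Rightarrow> int"
  assumes "X \<subseteq> D"
  shows "(\<Sum>h\<in>X. g (vert r (a h))) = (\<Sum>x\<in>verts D r. heads X x * g x)"
proof -
  have "(\<Sum>x\<in>verts D r. heads X x * g x)
      = (\<Sum>h\<in>X. \<Sum>x\<in>verts D r. of_bool (vert r (a h) = x) * g x)"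
    unfolding heads_def sum_distrib_right by (rule sum.swap)
  also have "\<dots> = (\<Sum>h\<in>X. g (vert r (a h)))"
  proof (rule sum.cong[OF refl])
    fix h assume "h \<in> X"
    then have "vert r (a h) \<in> verts D r" using assms by auto
    then show "(\<Sum>x\<in>verts D r. of_bool (vert r (a h) = x) * g x) = g (vert r (a h))"
      by (simp add: of_bool_def if_distrib[of "\<lambda>u. u * _"] sum.delta' cong: if_cong)
  qed
  finally show ?thesis by simp
qed

text \<open>Common arcs cancel, and \<open>a\<close> carries \<open>X - Y\<close> onto
  \<open>Y - X\<close>. With an indicator for \<open>g\<close>, differences of indegrees become net
  flows through the reversed arcs.\<close>

lemma sum_flip:
  fixes g :: "'d set \<Rightarrow> int"
  assumes X: "orientation X" and Y: "orientation Y"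
  shows "(\<Sum>h\<in>X - Y. g (vert r (a h)) - g (vert r h))
    = (\<Sum>h\<in>X. g (vert r (a h))) - (\<Sum>h\<in>Y. g (vert r (a h)))"
proof -
  note XD = orientationD[OF X] and YD = orientationD[OF Y]
  have img: "Y - X = a ` (X - Y)"
  proof (intro set_eqI iffI)
    fix h assume "h \<in> Y - X"
    then have "a h \<in> X - Y" "h = a (a h)"
      using XD(4)[of h] YD(3,4)[of h] by auto
    then show "h \<in> a ` (X - Y)" by blast
  next
    fix h assume "h \<in> a ` (X - Y)"
    then show "h \<in> Y - X" using XD(3,4) YD(4) by auto
  qed
  have inj: "inj_on a (X - Y)"
    by (rule inj_on_inverseI[of _ a]) (use XD in auto)
  have "(\<Sum>h\<in>Y - X. g (vert r (a h))) = (\<Sum>h\<in>X - Y. g (vert r h))"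
    unfolding img sum.reindex[OF inj] by (rule sum.cong) (use XD in auto)
  moreover have "sum G X = sum G (X \<inter> Y) + sum G (X - Y)" "sum G Y = sum G (X \<inter> Y) + sum G (Y - X)"
    for G :: "'d \<Rightarrow> int"
    using sum.Int_Diff[OF XD(2), of G Y] sum.Int_Diff[OF YD(2), of G X] by (simp_all add: Int_commute)
  ultimately show ?thesis
    by (simp add: sum_subtractf)
qed

lemma crossing_back:
  assumes "finite S" "k \<in> S" "vert r k \<notin> A" "vert r (a k) \<in> A"
    and "(\<Sum>h\<in>S. of_bool (vert r (a h) \<in> A) - of_bool (vert r h \<in> A)) \<le> (0::int)"
  obtains h where "h \<in> S" "vert r h \<in> A" "vert r (a h) \<notin> A"
proof (rule ccontr)
  assume "\<not> thesis"
  then have "\<forall>h\<in>S. 0 \<le> (of_bool (vert r (a h) \<in> A) - of_bool (vert r h \<in> A) :: int)"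
    using that by auto
  then have "0 < (\<Sum>h\<in>S. of_bool (vert r (a h) \<in> A) - of_bool (vert r h \<in> A) :: int)"
    using assms by (intro sum_pos2[of S k]) auto
  then show False using assms by simp
qed

text \<open>Equal indegrees make the reversed arcs a union of directed cycles, recorded as zero net
  flow into every \<open>A\<close>.\<close>

lemma heads_eq_balanced:
  assumes X: "orientation X" and Y: "orientation Y" and "heads X = heads Y"
  shows "(\<Sum>h\<in>X - Y. of_bool (vert r (a h) \<in> A) - of_bool (vert r h \<in> A)) = (0::int)"
  using sum_flip[OF X Y, of "\<lambda>x. of_bool (x \<in> A)"] sum_heads[of X "\<lambda>x. of_bool (x \<in> A)"]
    sum_heads[of Y "\<lambda>x. of_bool (x \<in> A)"] orientationD(1) assms by simp

text \<open>The reversed arcs amount to a path from \<open>x\<close> to \<open>y\<close> plus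
  cycles. If \<open>x\<close> lies in \<open>A\<close>, the net flow out of \<open>A\<close> is one,
  so some reversed arc left \<open>A\<close> and now enters it. Otherwise \<open>X\<close> has an
  arc entering \<open>A\<close>; if that arc is reversed, balance supplies a reversed arc leaving
  \<open>A\<close>.\<close>

lemma rooted_transfer:
  assumes X: "orientation X" and Y: "orientation Y" and root: "rooted X x"
    and flip: "\<And>g :: 'd set \<Rightarrow> int. (\<Sum>h\<in>X - Y. g (vert r (a h)) - g (vert r h)) = g y - g x"
  shows "rooted Y y"
  unfolding rooted_def
proof (intro allI impI)
  fix A assume "y \<notin> A" and "\<exists>h\<in>D. vert r h \<in> A"
  then obtain h where h: "h \<in> D" "vert r h \<in> A" by blast
  note XD = orientationD[OF X] and YD = orientationD[OF Y]
  let ?w = "\<lambda>h. of_bool (vert r (a h) \<in> A) - of_bool (vert r h \<in> A) :: int"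
  have sum: "sum ?w (X - Y) = - of_bool (x \<in> A)"
    using flip[of "\<lambda>x. of_bool (x \<in> A)"] \<open>y \<notin> A\<close> by simp
  have fin: "finite (X - Y)" using XD by simp
  have reverse: "\<exists>k\<in>Y. vert r k \<notin> A \<and> vert r (a k) \<in> A"
    if "k \<in> X - Y" "vert r k \<in> A" "vert r (a k) \<notin> A" for k
    using that XD(3)[of k] YD(4)[of k] by (intro bexI[of _ "a k"]) auto
  show "\<exists>k\<in>Y. vert r k \<notin> A \<and> vert r (a k) \<in> A"
  proof (cases "x \<in> A")
    case True
    then have "\<not> (\<forall>k\<in>X - Y. 0 \<le> ?w k)"
      using sum sum_nonneg[of "X - Y" ?w] by fastforce
    then obtain k where "k \<in> X - Y" "?w k < 0" by (meson not_le)
    then show ?thesis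
      by (intro reverse[of k]) (auto simp: of_bool_def split: if_splits)
  next
    case False
    then obtain k where k: "k \<in> X" "vert r k \<notin> A" "vert r (a k) \<in> A"
      using rootedE root h by metis
    show ?thesis
    proof (cases "k \<in> Y")
      case False
      then obtain h where "h \<in> X - Y" "vert r h \<in> A" "vert r (a h) \<notin> A"
        using crossing_back[of "X - Y" k A] fin k sum \<open>x \<notin> A\<close> by auto
      then show ?thesis by (rule reverse)
    qed (use k in blast)
  qed
qed

lemma rooted_heads_eq:
  assumes X: "orientation X" and Y: "orientation Y" and "rooted X x" and "heads X = heads Y"
  shows "rooted Y x"
proof (rule rooted_transfer[OF X Y \<open>rooted X x\<close>])
  fix g :: "'d set \<Rightarrow> int"
  show "(\<Sum>h\<in>X - Y. g (vert r (a h)) - g (vert r h)) = g x - g x"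
    using sum_flip[OF X Y, of g] sum_heads[of X g] sum_heads[of Y g] orientationD(1) assms by simp
qed

subsection \<open>The orientation attached to a break divisor\<close>

context
  fixes T q assumes T: "spanning_tree D a r T" and q: "q \<in> D"
begin

text \<open>For two tree arcs into one vertex, the tail of each lies on the far side of the other
  and so, by the interval property, is visited later; both cannot hold.\<close>

lemma parent_unique:
  assumes "p \<in> T" "fv T q p < fv T q (a p)" "p' \<in> T" "fv T q p' < fv T q (a p')"
    and "vert r (a p) = vert r (a p')"
  shows "p = p'"
proof (rule ccontr)
  assume "p \<noteq> p'"
  have less: "fv T q u < fv T q w"
    if uw: "u \<in> T" "fv T q u < fv T q (a u)" "w \<in> T" "fv T q w < fv T q (a w)"
      "vert r (a u) = vert r (a w)" "u \<noteq> w" for u w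
  proof -
    note cut = tree_cut_tree_side[OF T uw(1)]
    have "u \<in> D" "w \<in> D" using uw TD(4)[OF T] by auto
    have "vert r q \<notin> tree_side T u"
      using tree_cut_first[OF T q cut] uw by simp
    moreover have "w \<noteq> a u"
      using uw \<open>u \<in> D\<close> by auto
    then have "vert r w \<in> tree_side T u"
      using cut uw unfolding tree_cut_def by auto
    ultimately show ?thesis
      using tree_cut_interval[OF T q _ cut \<open>w \<in> D\<close>] by simp
  qed
  show False
    using less[of p p'] less[of p' p] assms \<open>p \<noteq> p'\<close> by simp
qed

lemma root_no_parent:
  assumes "p \<in> T" "fv T q p < fv T q (a p)"
  shows "vert r (a p) \<noteq> vert r q"
  using tree_cut_first[OF T q tree_cut_tree_side[OF T assms(1)]] assms
    tree_cut_tree_side[OF T assms(1)] unfolding tree_cut_def by auto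

text \<open>The predecessor of the earliest dart at \<open>A\<close> sits outside \<open>A\<close>,
  and the tour changes vertex only by walking along a tree edge.\<close>

lemma first_entry:
  assumes "vert r q \<notin> A" "h \<in> D" "vert r h \<in> A"
  obtains p where "p \<in> T" "fv T q p < fv T q (a p)" "vert r p \<notin> A" "vert r (a p) \<in> A"
proof -
  obtain k where k: "k \<in> D" "vert r k \<in> A"
    and min: "\<And>h. h \<in> D \<and> vert r h \<in> A \<Longrightarrow> fv T q k \<le> fv T q h"
    using ex_has_least_nat[of "\<lambda>h. h \<in> D \<and> vert r h \<in> A" h "fv T q"] assms by blast
  have "k \<noteq> q" using k assms by auto
  then obtain p where p: "p \<in> D" "k = tour_step a r T p" "fv T q k = Suc (fv T q p)"
    using fv_pred[OF T q k(1)] by blast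
  have out: "vert r p \<notin> A" using min[of p] p by auto
  then have "p \<in> T"
    using k p unfolding tour_step_def by (auto split: if_splits)
  moreover from this have in_A: "vert r (a p) \<in> A"
    using k p unfolding tour_step_def by auto
  moreover have "fv T q p < fv T q (a p)"
    using min[of "a p"] p in_A by simp
  ultimately show thesis using that out by blast
qed

lemma card_parents:
  assumes "x \<in> verts D r"
  shows "card {p \<in> T. fv T q p < fv T q (a p) \<and> vert r (a p) = x} = (if x = vert r q then 0 else 1)"
proof (cases "x = vert r q")
  case True
  then have none: "{p \<in> T. fv T q p < fv T q (a p) \<and> vert r (a p) = x} = {}"
    using root_no_parent by auto
  show ?thesis unfolding none using True by simp
next
  case False
  obtain h where h: "h \<in> D" "vert r h = x" using assms by (auto elim: vertsE)
  have "vert r q \<notin> {x}" "vert r h \<in> {x}" using False h by auto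
  then obtain p where p: "p \<in> T" "fv T q p < fv T q (a p)" "vert r (a p) \<in> {x}"
    using first_entry[OF _ h(1)] by metis
  have single: "{p \<in> T. fv T q p < fv T q (a p) \<and> vert r (a p) = x} = {p}"
  proof (intro set_eqI iffI)
    fix p' assume "p' \<in> {p \<in> T. fv T q p < fv T q (a p) \<and> vert r (a p) = x}"
    then show "p' \<in> {p}" using parent_unique[OF p(1,2), of p'] p(3) by simp
  qed (use p in simp)
  show ?thesis unfolding single using False by simp
qed

text \<open>\<open>C\<close> is meant to hold, for each non-tree edge, the dart at the chosen
  endpoint. The arc whose head is that endpoint is the partner of this dart, hence the image under
  \<open>a\<close>.\<close>

definition tree_orient :: "'d set \<Rightarrow> 'd set" where
  "tree_orient C = {h \<in> T. fv T q h < fv T q (a h)} \<union> a ` C"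

lemma fv_total:
  assumes "h \<in> D"
  shows "fv T q h < fv T q (a h) \<longleftrightarrow> \<not> fv T q (a h) < fv T q h"
  using fv_eq_iff[OF T q assms a_in[OF assms]] a_neq'[OF assms] by auto

lemma in_tree_orient:
  assumes "C \<subseteq> D - T" "h \<in> D"
  shows "h \<in> tree_orient C \<longleftrightarrow> (if h \<in> T then fv T q h < fv T q (a h) else a h \<in> C)"
proof -
  have "h \<in> a ` C \<longleftrightarrow> a h \<in> C"
  proof
    assume "a h \<in> C"
    then show "h \<in> a ` C" using assms by (intro image_eqI[of _ _ "a h"]) auto
  qed (use assms in auto)
  moreover have "h \<in> T \<Longrightarrow> a h \<notin> C"
    using assms TD(2)[OF T] by auto
  ultimately show ?thesis unfolding tree_orient_def by auto
qed

lemma orientation_tree_orient: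
  assumes C: "C \<subseteq> D - T" and choice: "\<And>h. h \<in> D - T \<Longrightarrow> h \<in> C \<longleftrightarrow> a h \<notin> C"
  shows "orientation (tree_orient C)"
  unfolding orientation_def
proof
  show "tree_orient C \<subseteq> D"
    using C TD(1)[OF T] unfolding tree_orient_def by auto
  show "\<forall>h\<in>D. h \<in> tree_orient C \<longleftrightarrow> a h \<notin> tree_orient C"
  proof
    fix h assume h: "h \<in> D"
    show "h \<in> tree_orient C \<longleftrightarrow> a h \<notin> tree_orient C"
      using in_tree_orient[OF C h] in_tree_orient[OF C a_in[OF h]] fv_total[OF h] choice[of h]
        TD(5)[OF T h] h by auto
  qed
qed

lemma rooted_tree_orient: "rooted (tree_orient C) (vert r q)"
  unfolding rooted_def
proof (intro allI impI)
  fix A assume "vert r q \<notin> A" "\<exists>h\<in>D. vert r h \<in> A"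
  then obtain p where "p \<in> T" "fv T q p < fv T q (a p)" "vert r p \<notin> A" "vert r (a p) \<in> A"
    using first_entry by metis
  then show "\<exists>k\<in>tree_orient C. vert r k \<notin> A \<and> vert r (a k) \<in> A"
    unfolding tree_orient_def by blast
qed

text \<open>The tree arcs put one unit on every vertex except the root
  (\<open>card_parents\<close>); this is the origin of both correction terms.\<close>

lemma heads_tree_orient:
  assumes C: "C \<subseteq> D - T"
  shows "int (card {h \<in> C. vert r h = x})
    = heads (tree_orient C) x - of_bool (x \<in> verts D r) + of_bool (x = vert r q)"
proof -
  let ?F = "{h \<in> T. fv T q h < fv T q (a h)}"
  have fin: "finite ?F" "finite C"
    using C TD(1)[OF T] finite_subset[OF _ finite_D] by auto
  have disj: "?F \<inter> a ` C = {}"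
    using C TD(5)[OF T] by auto
  have inj: "inj_on a C"
    by (rule inj_on_inverseI[of _ a]) (use C in auto)
  have "heads (tree_orient C) x = (\<Sum>h\<in>?F. of_bool (vert r (a h) = x)) + (\<Sum>h\<in>a ` C. of_bool (vert r (a h) = x))"
    unfolding heads_def tree_orient_def using fin disj by (intro sum.union_disjoint) auto
  also have "(\<Sum>h\<in>a ` C. of_bool (vert r (a h) = x)) = (\<Sum>h\<in>C. of_bool (vert r h = x) :: int)"
    unfolding sum.reindex[OF inj] by (rule sum.cong) (use C in auto)
  also have "\<dots> = int (card {h \<in> C. vert r h = x})"
    using fin by (simp add: Int_def)
  also have "(\<Sum>h\<in>?F. of_bool (vert r (a h) = x)) = int (card {p \<in> T. fv T q p < fv T q (a p) \<and> vert r (a p) = x})"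
    using fin by (simp add: Int_def)
  also have "\<dots> = of_bool (x \<in> verts D r) - of_bool (x = vert r q)"
  proof (cases "x \<in> verts D r")
    case True
    then show ?thesis using card_parents by simp
  next
    case False
    then have none: "{p \<in> T. fv T q p < fv T q (a p) \<and> vert r (a p) = x} = {}"
      using TD(4)[OF T] by auto
    have "x \<noteq> vert r q" using False q by auto
    then show ?thesis unfolding none using False by simp
  qed
  finally show ?thesis by simp
qed

end

definition bern_orient :: "'d \<Rightarrow> 'd set \<Rightarrow> 'd set" where
  "bern_orient q T = tree_orient T q {h \<in> D - T. fv T q h < fv T q (a h)}"

context
  fixes T q assumes T: "spanning_tree D a r T" and q: "q \<in> D"
begin

text \<open>A non-tree edge points to the endpoint cut first, so the orientation contains its later
  dart, while tree edges contribute their earlier dart. The resulting equivalence changes truth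
  value when \<open>T\<close> is complemented, which is what duality exploits.\<close>

lemma in_bern_orient:
  assumes "h \<in> D"
  shows "h \<in> bern_orient q T \<longleftrightarrow> (h \<in> T \<longleftrightarrow> fv T q h < fv T q (a h))"
proof -
  have "h \<in> bern_orient q T \<longleftrightarrow> (if h \<in> T then fv T q h < fv T q (a h)
      else a h \<in> {h \<in> D - T. fv T q h < fv T q (a h)})"
    unfolding bern_orient_def by (rule in_tree_orient[OF T q _ assms]) auto
  then show ?thesis
    using fv_total[OF T q assms] TD(5)[OF T assms] assms by simp
qed

lemma orientation_bern_orient: "orientation (bern_orient q T)"
  unfolding bern_orient_def
  by (rule orientation_tree_orient[OF T q]) (use fv_total[OF T q] TD(5)[OF T] in auto)

lemma rooted_bern_orient: "rooted (bern_orient q T) (vert r q)"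
  unfolding bern_orient_def by (rule rooted_tree_orient[OF T q])

lemma bernardi_eq_heads:
  "bernardi D a r q T x = heads (bern_orient q T) x - of_bool (x \<in> verts D r) + of_bool (x = vert r q)"
proof -
  let ?C = "{h \<in> D - T. fv T q h < fv T q (a h)}"
  have "bernardi D a r q T x = int (card {h \<in> ?C. vert r h = x})"
    unfolding bernardi_def by (simp add: conj_assoc)
  also have "\<dots> = heads (bern_orient q T) x - of_bool (x \<in> verts D r) + of_bool (x = vert r q)"
    unfolding bern_orient_def by (rule heads_tree_orient[OF T q]) auto
  finally show ?thesis .
qed

lemma bernardi_break_divisor: "bernardi D a r q T \<in> break_divisors D a r"
  unfolding break_divisors_def
proof (intro CollectI exI conjI)
  show "spanning_tree D a r T" by (rule T)
  show "\<forall>h\<in>D - T. h \<in> {h \<in> D - T. fv T q h < fv T q (a h)} \<longleftrightarrow> a h \<notin> {h \<in> D - T. fv T q h < fv T q (a h)}"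
    using fv_total[OF T q] TD(5)[OF T] by auto
  show "bernardi D a r q T = (\<lambda>x. int (card {h \<in> {h \<in> D - T. fv T q h < fv T q (a h)}. vert r h = x}))"
    unfolding bernardi_def by (auto simp: conj_assoc)
qed auto

end

lemma break_divisor_heads:
  assumes "B \<in> break_divisors D a r" "q \<in> D"
  obtains X where "orientation X" "rooted X (vert r q)"
    "\<And>x. B x = heads X x - of_bool (x \<in> verts D r) + of_bool (x = vert r q)"
proof -
  obtain T C where TC: "spanning_tree D a r T" "C \<subseteq> D - T" "\<forall>h\<in>D - T. h \<in> C \<longleftrightarrow> a h \<notin> C"
    "B = (\<lambda>x. int (card {h \<in> C. vert r h = x}))"
    using assms(1) unfolding break_divisors_def by blast
  show thesis
  proof (rule that)
    show "orientation (tree_orient T q C)"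
      using TC assms by (intro orientation_tree_orient) auto
    show "rooted (tree_orient T q C) (vert r q)"
      using TC assms by (intro rooted_tree_orient)
    show "B x = heads (tree_orient T q C) x - of_bool (x \<in> verts D r) + of_bool (x = vert r q)" for x
      using heads_tree_orient[OF TC(1) assms(2) TC(2)] TC(4) by simp
  qed
qed

subsection \<open>Uniqueness of break divisors in a linear equivalence class\<close>

definition principal :: "('d set \<Rightarrow> int) \<Rightarrow> bool" where
  "principal E \<longleftrightarrow> (\<exists>f. \<forall>x. E x = laplacian D a r f x)"

lemma lin_equiv_iff_principal: "lin_equiv D a r E F \<longleftrightarrow> principal (\<lambda>x. E x - F x)"
  unfolding lin_equiv_def principal_def ..

lemma principal_zero: "principal (\<lambda>x. 0)"
  unfolding principal_def laplacian_def by (rule exI[of _ "\<lambda>x. 0"]) simp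

lemma principal_add:
  assumes "principal E" "principal F"
  shows "principal (\<lambda>x. E x + F x)"
proof -
  obtain f g where f: "\<And>x. E x = laplacian D a r f x" and g: "\<And>x. F x = laplacian D a r g x"
    using assms unfolding principal_def by blast
  have "E x + F x = laplacian D a r (\<lambda>x. f x + g x) x" for x
    unfolding f g laplacian_def sum.distrib[symmetric] by (rule sum.cong) auto
  then show ?thesis unfolding principal_def by blast
qed

lemma principal_uminus:
  assumes "principal E"
  shows "principal (\<lambda>x. - E x)"
proof -
  obtain f where f: "\<And>x. E x = laplacian D a r f x"
    using assms unfolding principal_def by blast
  have "- E x = laplacian D a r (\<lambda>x. - f x) x" for x
    unfolding f laplacian_def sum_negf[symmetric] by (rule sum.cong) auto
  then show ?thesis unfolding principal_def by blast
qed

lemma principal_diff: "principal E \<Longrightarrow> principal F \<Longrightarrow> principal (\<lambda>x. E x - F x)"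
  using principal_add[OF _ principal_uminus, of E F] by simp

lemma sum_laplacian:
  "(\<Sum>x\<in>verts D r. laplacian D a r f x * g x) = (\<Sum>h\<in>D. (f (vert r h) - f (vert r (a h))) * g (vert r h))"
proof -
  have "(\<Sum>x\<in>verts D r. laplacian D a r f x * g x)
      = (\<Sum>x\<in>verts D r. \<Sum>h\<in>{h \<in> D. vert r h = x}. (f (vert r h) - f (vert r (a h))) * g (vert r h))"
    unfolding laplacian_def sum_distrib_right by (intro sum.cong) auto
  also have "\<dots> = (\<Sum>h\<in>D. (f (vert r h) - f (vert r (a h))) * g (vert r h))"
    by (rule sum.group) auto
  finally show ?thesis .
qed

text \<open>Let \<open>A\<close> be where \<open>f\<close> attains its maximum. Each edge leaving
  \<open>A\<close> adds at least 1 to the Laplacian summed over \<open>A\<close>. That sum is the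
  net flow of the reversed arcs into \<open>A\<close>, so at most the number of reversed arcs
  entering \<open>A\<close>. Rootedness makes this smaller than the number of edges at the boundary,
  unless \<open>A\<close> contains every vertex; then \<open>f\<close> is constant.\<close>

lemma rooted_heads_unique:
  assumes X: "orientation X" "rooted X x0" and Y: "orientation Y" "rooted Y x0"
    and x0: "x0 \<in> verts D r" and prin: "principal (\<lambda>x. heads X x - heads Y x)"
  shows "heads X = heads Y"
proof -
  obtain f where f: "\<And>x. heads X x - heads Y x = laplacian D a r f x"
    using prin unfolding principal_def by blast
  define M where "M = Max (f ` verts D r)"
  define A where "A = {x \<in> verts D r. f x = M}"
  have le_M: "f x \<le> M" if "x \<in> verts D r" for x
    unfolding M_def using that by (intro Max_ge) auto
  have "M \<in> f ` verts D r"
    unfolding M_def using x0 by (intro Max_in) auto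
  then obtain xM where xM: "xM \<in> A" unfolding A_def by blast
  then obtain hM where hM: "hM \<in> D" "vert r hM \<in> A"
    unfolding A_def by (auto elim: vertsE)
  have all: "vert r k \<in> A" if "k \<in> D" for k
  proof (rule ccontr)
    assume k: "vert r k \<notin> A"
    let ?out = "{h \<in> D. vert r h \<in> A \<and> vert r (a h) \<notin> A}"
    let ?in = "{h \<in> X - Y. vert r h \<notin> A \<and> vert r (a h) \<in> A}"
    have "int (card ?out) = (\<Sum>h\<in>D. of_bool (vert r h \<in> A \<and> vert r (a h) \<notin> A))"
      by (simp add: Int_def)
    also have "\<dots> \<le> (\<Sum>h\<in>D. (f (vert r h) - f (vert r (a h))) * of_bool (vert r h \<in> A))"
    proof (rule sum_mono)
      fix h assume h: "h \<in> D"
      have "f (vert r (a h)) \<noteq> M \<or> vert r (a h) \<in> A" using h unfolding A_def by auto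
      then show "of_bool (vert r h \<in> A \<and> vert r (a h) \<notin> A)
          \<le> (f (vert r h) - f (vert r (a h))) * of_bool (vert r h \<in> A)"
        using le_M[of "vert r (a h)"] h unfolding A_def by auto
    qed
    also have "\<dots> = (\<Sum>x\<in>verts D r. (heads X x - heads Y x) * of_bool (x \<in> A))"
      unfolding f sum_laplacian ..
    also have "\<dots> = (\<Sum>h\<in>X - Y. of_bool (vert r (a h) \<in> A) - of_bool (vert r h \<in> A))"
      using sum_flip[OF X(1) Y(1), of "\<lambda>x. of_bool (x \<in> A)"]
        sum_heads[of X "\<lambda>x. of_bool (x \<in> A)"] sum_heads[of Y "\<lambda>x. of_bool (x \<in> A)"]
        orientationD(1) X Y by (simp add: left_diff_distrib sum_subtractf)
    also have "\<dots> \<le> (\<Sum>h\<in>X - Y. of_bool (vert r h \<notin> A \<and> vert r (a h) \<in> A))"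
      by (rule sum_mono) auto
    also have "\<dots> = int (card ?in)"
      using orientationD(2)[OF X(1)] by (simp add: Int_def)
    also have "card ?in = card (a ` ?in)"
      by (rule card_image[symmetric], rule inj_on_inverseI[of _ a])
        (use orientationD(3)[OF X(1)] in auto)
    \<comment> \<open>Some boundary edge is not an arc of \<open>X - Y\<close> entering
      \<open>A\<close>: if the root is in \<open>A\<close>, an arc of \<open>X\<close> leaves
      \<open>A\<close>; otherwise an arc of \<open>Y\<close> enters \<open>A\<close>.\<close>
    also have "int (card (a ` ?in)) < int (card ?out)"
    proof -
      have "a ` ?in \<subseteq> ?out"
        using orientationD(3)[OF X(1)] by auto
      moreover have "a ` ?in \<noteq> ?out"
      proof (cases "x0 \<in> A")
        case True
        then obtain l where "l \<in> X" "vert r l \<notin> - A" "vert r (a l) \<in> - A"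
          using rootedE[OF X(2), of "- A" k] k \<open>k \<in> D\<close> by auto
        moreover from this have "l \<notin> a ` ?in"
          using orientationD(3,4)[OF X(1)] by auto
        ultimately show ?thesis
          using orientationD(3)[OF X(1)] by auto
      next
        case False
        then obtain l where l: "l \<in> Y" "vert r l \<notin> A" "vert r (a l) \<in> A"
          using rootedE[OF Y(2) _ hM] by blast
        have "a l \<notin> a ` ?in"
        proof
          assume "a l \<in> a ` ?in"
          then obtain m where "m \<in> X - Y" "a l = a m" by blast
          moreover have "a (a l) = l" "a (a m) = m"
            using \<open>m \<in> X - Y\<close> l orientationD(3)[OF X(1)] orientationD(3)[OF Y(1)] by auto
          ultimately have "l = m" by metis
          then show False using \<open>m \<in> X - Y\<close> l by simp
        qed
        moreover have "a l \<in> ?out" using l orientationD(3)[OF Y(1)] by auto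
        ultimately show ?thesis by metis
      qed
      ultimately show ?thesis
        by (intro iffD2[OF of_nat_less_iff] psubset_card_mono) auto
    qed
    finally show False by simp
  qed
  have "laplacian D a r f x = 0" for x
    unfolding laplacian_def using all unfolding A_def by (intro sum.neutral) auto
  then show ?thesis using f by (intro ext) (metis eq_iff_diff_eq_0)
qed

subsection \<open>Injectivity of the Bernardi map\<close>

lemma tour_agree:
  assumes T: "spanning_tree D a r T" and "q \<in> D"
    and agree: "\<And>k. k \<in> D \<Longrightarrow> fv T q k < n \<Longrightarrow> k \<in> T \<longleftrightarrow> k \<in> T'" and "m \<le> n"
  shows "(tour_step a r T ^^ m) q = (tour_step a r T' ^^ m) q"
  using \<open>m \<le> n\<close>
proof (induction m)
  case (Suc m)
  let ?p = "(tour_step a r T ^^ m) q"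
  have "fv T q ?p \<le> m" unfolding first_visit_def by (rule Least_le) simp
  then have "?p \<in> T \<longleftrightarrow> ?p \<in> T'"
    using Suc.prems by (intro agree tour_in[OF T \<open>q \<in> D\<close>]) auto
  moreover have "(tour_step a r T ^^ m) q = (tour_step a r T' ^^ m) q"
    using Suc by simp
  ultimately show ?case unfolding tour_step_def by simp
qed simp

context
  fixes T T' q n
  assumes T: "spanning_tree D a r T" and T': "spanning_tree D a r T'" and q: "q \<in> D"
    and agree: "\<And>k. k \<in> D \<Longrightarrow> fv T q k < n \<Longrightarrow> k \<in> T \<longleftrightarrow> k \<in> T'"
begin

lemma fv_agree1:
  assumes k: "k \<in> D" and "fv T q k \<le> n"
  shows "fv T' q k = fv T q k"
proof (rule antisym)
  note tour = tour_agree[OF T q agree]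
  show *: "fv T' q k \<le> fv T q k"
    using tour[OF _ _ assms(2)] tour_fv[OF T q k] by (intro fv_le[OF T']) auto
  then have "fv T' q k \<le> n" using assms(2) by simp
  then show "fv T q k \<le> fv T' q k"
    using tour[of "fv T' q k"] tour_fv[OF T' q k] by (intro fv_le[OF T]) auto
qed

lemma fv_agree2:
  assumes k: "k \<in> D" and "fv T' q k \<le> n"
  shows "fv T' q k = fv T q k"
proof -
  have "fv T q k \<le> fv T' q k"
    using tour_agree[OF T q agree assms(2)] tour_fv[OF T' q k] by (intro fv_le[OF T]) auto
  then show ?thesis
    using fv_agree1[OF k] assms(2) by simp
qed

text \<open>At the divergence \<open>h\<close> lies in the first orientation only, so balance gives
  a reversed arc \<open>k\<close> leaving the far side of \<open>h\<close> in \<open>T\<close>. It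
  is a non-tree dart whose partner is visited earlier; by the interval property that partner even
  precedes \<open>h\<close>. There the two tours still agree, so \<open>k\<close> belongs to both
  orientations.\<close>

lemma bern_orient_diverge:
  assumes eq: "heads (bern_orient q T) = heads (bern_orient q T')"
    and h: "h \<in> T" "h \<notin> T'" "fv T q h = n"
  shows False
proof -
  let ?X = "bern_orient q T" and ?Y = "bern_orient q T'"
  have "h \<in> D" using TD(4)[OF T] h by blast
  note cut = tree_cut_tree_side[OF T h(1)]
  let ?A = "tree_side T h"
  have "\<not> fv T q (a h) < n"
    using agree[of "a h"] TD(5)[OF T \<open>h \<in> D\<close>] TD(5)[OF T' \<open>h \<in> D\<close>] h \<open>h \<in> D\<close> by auto
  then have first: "fv T q h < fv T q (a h)"
    using fv_total[OF T q \<open>h \<in> D\<close>] h by simp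
  have "h \<in> ?X"
    using in_bern_orient[OF T q \<open>h \<in> D\<close>] first h by simp
  moreover have "fv T' q h < fv T' q (a h)"
    using fv_agree1[OF \<open>h \<in> D\<close>] fv_agree2[of "a h"] \<open>h \<in> D\<close> first h by force
  then have "h \<notin> ?Y"
    using in_bern_orient[OF T' q \<open>h \<in> D\<close>] h by simp
  moreover have "vert r h \<notin> ?A" "vert r (a h) \<in> ?A"
    using cut unfolding tree_cut_def by auto
  moreover note orientation_bern_orient[OF T q] orientation_bern_orient[OF T' q]
  ultimately obtain k where k: "k \<in> ?X - ?Y" "vert r k \<in> ?A" "vert r (a k) \<notin> ?A"
    using crossing_back[of "?X - ?Y" h ?A] heads_eq_balanced[of ?X ?Y ?A] eq orientationD(2) by auto
  have "k \<in> D" using k orientationD(3)[OF orientation_bern_orient[OF T q]] by blast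
  have "k \<notin> T"
  proof
    assume "k \<in> T"
    then have "k = a h" using tree_cut_cross[OF cut] k by blast
    then show False
      using k orientationD(4)[OF orientation_bern_orient[OF T q] \<open>h \<in> D\<close>] \<open>h \<in> ?X\<close> by simp
  qed
  then have second: "fv T q (a k) < fv T q k"
    using k in_bern_orient[OF T q \<open>k \<in> D\<close>] fv_total[OF T q \<open>k \<in> D\<close>] by auto
  have "vert r q \<notin> ?A" using tree_cut_first[OF T q cut] first by simp
  note interval = tree_cut_interval[OF T q this cut]
  have "n < fv T q k" "fv T q (a k) \<le> n"
    using interval[OF \<open>k \<in> D\<close>] interval[of "a k"] k second \<open>k \<in> D\<close> h by auto
  moreover have "a k \<noteq> h" using h \<open>k \<notin> T\<close> TD(5)[OF T \<open>k \<in> D\<close>] by auto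
  then have "fv T q (a k) \<noteq> n" using fv_eq_iff[OF T q a_in[OF \<open>k \<in> D\<close>] \<open>h \<in> D\<close>] h by simp
  ultimately have ak: "fv T q (a k) < n" "n < fv T q k" by auto
  then have "k \<notin> T'"
    using agree[of "a k"] \<open>k \<in> D\<close> \<open>k \<notin> T\<close> TD(5)[OF T \<open>k \<in> D\<close>] TD(5)[OF T' \<open>k \<in> D\<close>] by simp
  moreover have "fv T' q (a k) < fv T' q k"
    using fv_agree1[of "a k"] fv_agree2[OF \<open>k \<in> D\<close>] ak \<open>k \<in> D\<close> by force
  ultimately have "k \<in> ?Y"
    using in_bern_orient[OF T' q \<open>k \<in> D\<close>] by simp
  then show False using k by simp
qed

end

lemma bern_orient_inj:
  assumes T: "spanning_tree D a r T" and T': "spanning_tree D a r T'" and q: "q \<in> D"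
    and eq: "heads (bern_orient q T) = heads (bern_orient q T')"
  shows "T = T'"
proof (rule ccontr)
  assume "T \<noteq> T'"
  then have "\<exists>h. h \<in> D \<and> (h \<in> T \<longleftrightarrow> h \<notin> T')"
    using TD(1)[OF T] TD(1)[OF T'] by blast
  then obtain h where h: "h \<in> D" "h \<in> T \<longleftrightarrow> h \<notin> T'"
    and min: "\<And>k. k \<in> D \<and> (k \<in> T \<longleftrightarrow> k \<notin> T') \<Longrightarrow> fv T q h \<le> fv T q k"
    using ex_has_least_nat[of "\<lambda>h. h \<in> D \<and> (h \<in> T \<longleftrightarrow> h \<notin> T')" _ "fv T q"] by blast
  have agree: "k \<in> T \<longleftrightarrow> k \<in> T'" if "k \<in> D" "fv T q k < fv T q h" for k
    using min[of k] that by auto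
  have agree': "k \<in> T' \<longleftrightarrow> k \<in> T" if "k \<in> D" "fv T' q k < fv T q h" for k
    using agree[OF that(1)] fv_agree2[OF T T' q agree that(1)] that by simp
  have "fv T' q h = fv T q h"
    using fv_agree1[OF T T' q agree h(1)] by simp
  then show False
    using bern_orient_diverge[OF T T' q agree eq] bern_orient_diverge[OF T' T q agree' eq[symmetric]] h
    by auto
qed

subsection \<open>Exchanging edges of spanning trees\<close>

lemma connected_const:
  assumes "connected_via D a r S" "\<And>h. h \<in> S \<Longrightarrow> G (vert r h) = G (vert r (a h))" "h \<in> D" "k \<in> D"
  shows "G (vert r h) = G (vert r k)"
proof -
  have "(vert r h, vert r k) \<in> (link a r S)\<^sup>*"
    using assms unfolding connected_via_def by blast
  then show ?thesis
  proof induction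
    case (step y z)
    then show ?case using assms(2) unfolding link_def by force
  qed simp
qed

text \<open>Heads of parent arcs biject with the vertices other than the root; the factor 2 counts
  both darts of an edge.\<close>

lemma card_spanning_tree:
  assumes T: "spanning_tree D a r T" and q: "q \<in> D"
  shows "card T = 2 * (card (verts D r) - 1)"
proof -
  let ?F = "{p \<in> T. fv T q p < fv T q (a p)}"
  have fin: "finite ?F" using TD(1)[OF T] finite_subset[OF _ finite_D] by auto
  have union: "T = ?F \<union> a ` ?F"
  proof (intro set_eqI iffI)
    fix h assume h: "h \<in> T"
    then have "h \<in> ?F \<or> a h \<in> ?F" "h = a (a h)"
      using fv_total[OF T q TD(4)[OF T h]] TD(2,4)[OF T h] by auto
    then show "h \<in> ?F \<union> a ` ?F" by blast
  next
    fix h assume "h \<in> ?F \<union> a ` ?F"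
    then show "h \<in> T" using TD(2)[OF T] by auto
  qed
  have "?F \<inter> a ` ?F = {}" using TD(4)[OF T] by auto
  moreover have "card (a ` ?F) = card ?F"
    by (rule card_image, rule inj_on_inverseI[of _ a]) (use TD(4)[OF T] in auto)
  ultimately have "card T = 2 * card ?F"
    using card_Un_disjoint[of ?F "a ` ?F"] fin union by simp
  moreover have "bij_betw (\<lambda>p. vert r (a p)) ?F (verts D r - {vert r q})"
    unfolding bij_betw_def
  proof
    show "inj_on (\<lambda>p. vert r (a p)) ?F"
      by (rule inj_onI) (use parent_unique[OF T q] in auto)
    show "(\<lambda>p. vert r (a p)) ` ?F = verts D r - {vert r q}"
    proof (intro set_eqI iffI)
      fix x assume "x \<in> (\<lambda>p. vert r (a p)) ` ?F"
      then show "x \<in> verts D r - {vert r q}"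
        using root_no_parent[OF T q] TD(4)[OF T] by auto
    next
      fix x assume x: "x \<in> verts D r - {vert r q}"
      then obtain h where h: "h \<in> D" "vert r h \<in> {x}" by (auto elim: vertsE)
      have "vert r q \<notin> {x}" using x by auto
      then obtain p where "p \<in> ?F" "vert r (a p) \<in> {x}"
        using first_entry[OF T q _ h] by (metis (mono_tags, lifting) mem_Collect_eq)
      then show "x \<in> (\<lambda>p. vert r (a p)) ` ?F" by auto
    qed
  qed
  then have "card ?F = card (verts D r) - 1"
    using bij_betw_same_card vert_in_verts[OF q] by fastforce
  ultimately show ?thesis by simp
qed

text \<open>A smallest connected set of edges is acyclic: an edge whose endpoints are joined without
  it could be dropped.\<close>

lemma connected_contains_tree:
  assumes S: "S \<subseteq> D" "\<And>h. h \<in> S \<Longrightarrow> a h \<in> S" "connected_via D a r S"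
  obtains T where "T \<subseteq> S" "spanning_tree D a r T"
proof -
  define P where "P S' \<longleftrightarrow> S' \<subseteq> S \<and> (\<forall>h\<in>S'. a h \<in> S') \<and> connected_via D a r S'" for S'
  have "P S" using S unfolding P_def by blast
  then obtain T where T: "P T" and min: "\<And>S'. P S' \<Longrightarrow> card T \<le> card S'"
    using ex_has_least_nat[of P S card] by blast
  have TS: "T \<subseteq> S" "\<And>h. h \<in> T \<Longrightarrow> a h \<in> T" "connected_via D a r T" "T \<subseteq> D"
    using T S(1) unfolding P_def by auto
  have acyclic: "(vert r h, vert r (a h)) \<notin> (link a r (T - edge_of a h))\<^sup>*" if h: "h \<in> T" for h
  proof
    let ?L = "link a r (T - edge_of a h)"
    assume path: "(vert r h, vert r (a h)) \<in> ?L\<^sup>*"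
    have "h \<in> D" using h TS by blast
    note closed = remove_edge_closed[OF TS(4,2) \<open>h \<in> D\<close>]
    have back_path: "(vert r (a h), vert r h) \<in> ?L\<^sup>*"
      using link_sym[OF closed] path by (auto dest: symD)
    have "link a r T \<subseteq> ?L\<^sup>*"
    proof
      fix z assume "z \<in> link a r T"
      then obtain k where k: "k \<in> T" "z = (vert r k, vert r (a k))" unfolding link_def by blast
      consider "k = h" | "k = a h" | "k \<in> T - edge_of a h" using k unfolding edge_of_def by blast
      then show "z \<in> ?L\<^sup>*"
      proof cases
        case 3
        then have "z \<in> ?L" using k unfolding link_def by blast
        then show ?thesis ..
      qed (use k path back_path a_a[OF \<open>h \<in> D\<close>] in simp_all)
    qed
    then have "(link a r T)\<^sup>* \<subseteq> ?L\<^sup>*"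
      by (rule rtrancl_subset_rtrancl)
    then have "connected_via D a r (T - edge_of a h)"
      using TS(3) unfolding connected_via_def by blast
    then have "P (T - edge_of a h)"
      using closed(2) TS(1) unfolding P_def by blast
    moreover have "card (T - edge_of a h) < card T"
      using h finite_subset[OF TS(4)] unfolding edge_of_def by (intro psubset_card_mono) auto
    ultimately show False using min[of "T - edge_of a h"] by simp
  qed
  have "spanning_tree D a r T"
    unfolding spanning_tree_def using TS acyclic by blast
  then show thesis using that TS(1) by blast
qed

lemma spanning_tree_if_card:
  assumes S: "S \<subseteq> D" "\<And>h. h \<in> S \<Longrightarrow> a h \<in> S" "connected_via D a r S" and q: "q \<in> D"
    and card: "card S = 2 * (card (verts D r) - 1)"
  shows "spanning_tree D a r S"
proof -
  obtain T where T: "T \<subseteq> S" "spanning_tree D a r T"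
    using connected_contains_tree[OF S] by blast
  have "T = S"
    using card_subset_eq[OF _ T(1)] finite_subset[OF S(1)] card card_spanning_tree[OF T(2) q] by simp
  then show ?thesis using T by simp
qed

text \<open>Without \<open>f\<close> the tree falls into the far side and the component of the tail
  of \<open>f\<close> (fact \<open>far\<close>); \<open>e\<close> rejoins them, and acyclicity
  follows from the count of darts.\<close>

lemma tree_exchange:
  assumes T: "spanning_tree D a r T" and f: "f \<in> T"
    and e: "e \<in> D" "vert r e \<notin> tree_side T f" "vert r (a e) \<in> tree_side T f" "e \<notin> T"
  shows "spanning_tree D a r (T - edge_of a f \<union> edge_of a e)"
proof -
  let ?L = "link a r (T - edge_of a f)" and ?A = "tree_side T f" and ?T = "T - edge_of a f \<union> edge_of a e"
  have "f \<in> D" using TD(4)[OF T f] .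
  note closed = remove_edge_closed[OF TD(1,2)[OF T] \<open>f \<in> D\<close>]
  have T'D: "?T \<subseteq> D" using closed(1) e unfolding edge_of_def by auto
  have T'a: "\<And>h. h \<in> ?T \<Longrightarrow> a h \<in> ?T"
    using closed(2) a_a[OF e(1)] unfolding edge_of_def by fastforce
  have far: "x \<in> ?A \<or> (vert r f, x) \<in> ?L\<^sup>*" if "(vert r f, x) \<in> (link a r T)\<^sup>*" for x
    using that
  proof induction
    case (step y z)
    from \<open>(y, z) \<in> link a r T\<close> obtain h where h: "h \<in> T" "y = vert r h" "z = vert r (a h)"
      unfolding link_def by blast
    consider "h = f" | "h = a f" | "h \<in> T - edge_of a f"
      using h unfolding edge_of_def by blast
    then show ?case
    proof cases
      case 1
      then show ?thesis using h unfolding tree_side_def by simp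
    next
      case 2
      then show ?thesis using h \<open>f \<in> D\<close> by simp
    next
      case 3
      then have "(y, z) \<in> ?L" using h unfolding link_def by blast
      then show ?thesis
        using step.IH unfolding tree_side_def by (auto intro: rtrancl_into_rtrancl)
    qed
  qed simp
  have conn: "(vert r f, vert r k) \<in> (link a r T)\<^sup>*" if "k \<in> D" for k
    using TD(3)[OF T] \<open>f \<in> D\<close> that unfolding connected_via_def by blast
  have "?L \<subseteq> link a r ?T" unfolding link_def by blast
  then have mono: "?L\<^sup>* \<subseteq> (link a r ?T)\<^sup>*" by (rule rtrancl_mono)
  have sym: "sym ((link a r ?T)\<^sup>*)" by (rule link_sym[OF T'D T'a])
  have "(vert r f, vert r e) \<in> (link a r ?T)\<^sup>*"
    using far[OF conn[OF e(1)]] e mono by blast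
  moreover have "(vert r e, vert r (a e)) \<in> (link a r ?T)\<^sup>*"
    unfolding link_def edge_of_def by blast
  moreover have "(vert r (a e), vert r (a f)) \<in> (link a r ?T)\<^sup>*"
    using e(3) mono sym unfolding tree_side_def by (auto dest: symD)
  ultimately have join: "(vert r f, vert r (a f)) \<in> (link a r ?T)\<^sup>*"
    by (blast intro: rtrancl_trans)
  have all: "(vert r f, vert r k) \<in> (link a r ?T)\<^sup>*" if "k \<in> D" for k
  proof (cases "vert r k \<in> ?A")
    case True
    then have "(vert r (a f), vert r k) \<in> (link a r ?T)\<^sup>*"
      using mono unfolding tree_side_def by blast
    then show ?thesis using join by (blast intro: rtrancl_trans)
  next
    case False
    then show ?thesis using far[OF conn[OF that]] mono by blast
  qed
  have "connected_via D a r ?T"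
    unfolding connected_via_def
  proof (intro ballI)
    fix h k assume "h \<in> D" "k \<in> D"
    then show "(vert r h, vert r k) \<in> (link a r ?T)\<^sup>*"
      using all[of h] all[of k] sym by (blast dest: symD intro: rtrancl_trans)
  qed
  moreover have "card ?T = card T"
  proof -
    have "edge_of a f \<subseteq> T" "a e \<notin> T"
      using f TD(2)[OF T f] TD(5)[OF T e(1)] e(4) unfolding edge_of_def by auto
    then have "card (T - edge_of a f) + 2 = card T"
      using card_Diff_subset[of "edge_of a f" T] card_mono[of T "edge_of a f"]
        finite_subset[OF TD(1)[OF T]] \<open>f \<in> D\<close> by (simp add: edge_of_def)
    moreover have "card ?T = card (T - edge_of a f) + 2"
      using card_Un_disjoint[of "T - edge_of a f" "edge_of a e"] e \<open>a e \<notin> T\<close>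
        finite_subset[OF TD(1)[OF T]] by (simp add: edge_of_def)
    ultimately show ?thesis by simp
  qed
  ultimately show ?thesis
    using spanning_tree_if_card[OF T'D T'a _ \<open>f \<in> D\<close>] card_spanning_tree[OF T \<open>f \<in> D\<close>] by simp
qed

subsection \<open>Tree potentials and reorientation along paths\<close>

context
  fixes T q assumes T: "spanning_tree D a r T" and q: "q \<in> D"
begin

abbreviation "arcs \<equiv> {p \<in> T. fv T q p < fv T q (a p)}"

lemma finite_arcs: "finite arcs"
  by (rule finite_subset[OF _ finite_D]) (use TD(4)[OF T] in auto)

text \<open>A vertex \<open>x\<close> lies in \<open>tree_side T p\<close> exactly when the arc
  \<open>p\<close> is on the tree path from the root to \<open>x\<close>, so this integrates
  \<open>w\<close> along that path.\<close>

definition potential :: "('d \<Rightarrow> int) \<Rightarrow> 'd set \<Rightarrow> int" where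
  "potential w x = (\<Sum>p\<in>arcs. of_bool (x \<in> tree_side T p) * w p)"

lemma potential_root: "potential w (vert r q) = 0"
  unfolding potential_def
proof (rule sum.neutral, rule ballI)
  fix p assume p: "p \<in> arcs"
  then have "vert r q \<notin> tree_side T p"
    using tree_cut_first[OF T q tree_cut_tree_side[OF T]] by simp
  then show "of_bool (vert r q \<in> tree_side T p) * w p = 0" by simp
qed

lemma potential_diff:
  assumes f: "f \<in> arcs"
  shows "potential w (vert r (a f)) - potential w (vert r f) = w f"
proof -
  have "potential w (vert r (a f)) - potential w (vert r f) = (\<Sum>p\<in>arcs. if p = f then w f else 0)"
    unfolding potential_def sum_subtractf[symmetric]
  proof (rule sum.cong[OF refl])
    fix p assume p: "p \<in> arcs"
    then have cut: "tree_cut T p (tree_side T p)"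
      using tree_cut_tree_side[OF T] by blast
    have "f \<noteq> a p"
      using p f TD(4)[OF T] by auto
    then have "p \<noteq> f \<Longrightarrow> vert r f \<in> tree_side T p \<longleftrightarrow> vert r (a f) \<in> tree_side T p"
      using cut f unfolding tree_cut_def by auto
    then show "of_bool (vert r (a f) \<in> tree_side T p) * w p - of_bool (vert r f \<in> tree_side T p) * w p
        = (if p = f then w f else 0)"
      using cut unfolding tree_cut_def by auto
  qed
  also have "\<dots> = w f"
    using finite_arcs f by (simp add: sum.delta)
  finally show ?thesis .
qed

lemma potential_exact:
  assumes "h \<in> D"
  shows "potential (\<lambda>p. g (vert r (a p)) - g (vert r p)) (vert r h) = g (vert r h) - g (vert r q)"
proof -
  let ?G = "\<lambda>x. potential (\<lambda>p. g (vert r (a p)) - g (vert r p)) x - g x"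
  have "?G (vert r h) = ?G (vert r q)"
  proof (rule connected_const[OF TD(3)[OF T], where G = ?G])
    fix k assume k: "k \<in> T"
    have "k \<in> D" using TD(4)[OF T k] .
    show "?G (vert r k) = ?G (vert r (a k))"
    proof (cases "fv T q k < fv T q (a k)")
      case True
      then show ?thesis using potential_diff[of k "\<lambda>p. g (vert r (a p)) - g (vert r p)"] k by simp
    next
      case False
      then have "a k \<in> arcs" using fv_total[OF T q \<open>k \<in> D\<close>] TD(2)[OF T k] \<open>k \<in> D\<close> by simp
      then show ?thesis
        using potential_diff[of "a k" "\<lambda>p. g (vert r (a p)) - g (vert r p)"] \<open>k \<in> D\<close> by simp
    qed
  qed (use assms q in auto)
  then show ?thesis using potential_root by simp
qed

end

definition flip :: "'d set \<Rightarrow> 'd set \<Rightarrow> 'd set" where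
  "flip X S = X - S \<union> a ` S"

lemma in_flip:
  assumes X: "orientation X" and "S \<subseteq> X" "h \<in> D"
  shows "h \<in> flip X S \<longleftrightarrow> (h \<in> X \<and> h \<notin> S) \<or> a h \<in> S"
proof -
  have "h \<in> a ` S \<longleftrightarrow> a h \<in> S"
  proof
    assume "a h \<in> S"
    then show "h \<in> a ` S" using assms by (intro image_eqI[of _ _ "a h"]) auto
  qed (use assms orientationD(3)[OF X] in auto)
  then show ?thesis unfolding flip_def by blast
qed

lemma
  assumes X: "orientation X" and S: "S \<subseteq> X"
  shows orientation_flip: "orientation (flip X S)" and minus_flip: "X - flip X S = S"
proof -
  show "orientation (flip X S)"
    unfolding orientation_def
  proof
    show "flip X S \<subseteq> D" using S orientationD(3)[OF X] unfolding flip_def by auto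
    show "\<forall>h\<in>D. h \<in> flip X S \<longleftrightarrow> a h \<notin> flip X S"
    proof
      fix h assume h: "h \<in> D"
      show "h \<in> flip X S \<longleftrightarrow> a h \<notin> flip X S"
        using in_flip[OF X S h] in_flip[OF X S a_in[OF h]] orientationD(4)[OF X h] S h by auto
    qed
  qed
  show "X - flip X S = S"
  proof (intro set_eqI iffI)
    fix h assume h: "h \<in> X - flip X S"
    then show "h \<in> S" using in_flip[OF X S, of h] orientationD(3)[OF X] by auto
  next
    fix h assume h: "h \<in> S"
    then have "h \<in> X" "h \<in> D" using S orientationD(3)[OF X] by auto
    then show "h \<in> X - flip X S"
      using in_flip[OF X S \<open>h \<in> D\<close>] orientationD(4)[OF X \<open>h \<in> D\<close>] S h by auto
  qed
qed

lemma heads_flip: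
  assumes X: "orientation X" and S: "S \<subseteq> X"
  shows "heads X x - heads (flip X S) x = (\<Sum>h\<in>S. of_bool (vert r (a h) = x) - of_bool (vert r h = x))"
  using sum_flip[OF X orientation_flip[OF assms], of "\<lambda>y. of_bool (y = x)"] minus_flip[OF assms]
  unfolding heads_def by simp

text \<open>The path is cut at its last departure from \<open>x\<close>.\<close>

lemma leave_once:
  assumes "(x, y) \<in> (link a r S)\<^sup>*" "x \<noteq> y"
  obtains h where "h \<in> S" "vert r h = x" "(vert r (a h), y) \<in> (link a r {k \<in> S. vert r k \<noteq> x})\<^sup>*"
proof -
  have "x = y \<or> (\<exists>h\<in>S. vert r h = x \<and> (vert r (a h), y) \<in> (link a r {k \<in> S. vert r k \<noteq> x})\<^sup>*)"
    using assms(1)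
  proof induction
    case (step y z)
    from \<open>(y, z) \<in> link a r S\<close> obtain k where k: "k \<in> S" "y = vert r k" "z = vert r (a k)"
      unfolding link_def by blast
    show ?case
    proof (cases "y = x")
      case True
      then show ?thesis using k by blast
    next
      case False
      then have "(y, z) \<in> link a r {k \<in> S. vert r k \<noteq> x}"
        using k unfolding link_def by blast
      then show ?thesis using step.IH False by (blast intro: rtrancl_into_rtrancl)
    qed
  qed simp
  then show thesis using that assms(2) by blast
qed

text \<open>After each departure the arcs out of the vertex just left are discarded, so no arc is
  used twice and the telescoping sum along the path is a sum over a set. Testing against all
  \<open>g\<close> expresses that its boundary is the end minus the start.\<close>

lemma path_set:
  assumes "finite S" "(x, y) \<in> (link a r S)\<^sup>*"
  obtains S' where "S' \<subseteq> S"
    "\<And>g :: 'd set \<Rightarrow> int. (\<Sum>h\<in>S'. g (vert r (a h)) - g (vert r h)) = g y - g x"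
proof -
  have "\<exists>S'\<subseteq>S. \<forall>g :: 'd set \<Rightarrow> int. (\<Sum>h\<in>S'. g (vert r (a h)) - g (vert r h)) = g y - g x"
    using assms
  proof (induction "card S" arbitrary: S x rule: less_induct)
    case less
    show ?case
    proof (cases "x = y")
      case True
      then show ?thesis by (intro exI[of _ "{}"]) simp
    next
      case False
      then obtain h where h: "h \<in> S" "vert r h = x"
        "(vert r (a h), y) \<in> (link a r {k \<in> S. vert r k \<noteq> x})\<^sup>*"
        using leave_once[OF less.prems(2)] by blast
      have "card {k \<in> S. vert r k \<noteq> x} < card S"
        using h less.prems by (intro psubset_card_mono) auto
      then obtain S' where S': "S' \<subseteq> {k \<in> S. vert r k \<noteq> x}"
        "\<forall>g :: 'd set \<Rightarrow> int. (\<Sum>h\<in>S'. g (vert r (a h)) - g (vert r h)) = g y - g (vert r (a h))"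
        using less.hyps[OF _ _ h(3)] less.prems(1) by auto
      have "S' \<subseteq> S" "h \<notin> S'" using S'(1) h by auto
      then have "finite S'" "h \<notin> S'" using finite_subset less.prems(1) by blast+
      then have "\<forall>g :: 'd set \<Rightarrow> int. (\<Sum>h\<in>insert h S'. g (vert r (a h)) - g (vert r h)) = g y - g x"
        using S'(2) h by simp
      then show ?thesis using S'(1) h(1) by (intro exI[of _ "insert h S'"]) auto
    qed
  qed
  then show thesis using that by blast
qed

subsection \<open>Surjectivity of the Bernardi map\<close>

text \<open>The second clause says that no directed cycle through a tree dart avoids the edges visited
before it. It survives reversals of later cycles, and it is what keeps the greedy tour from walking
along an edge to a vertex that it has already visited.\<close>

definition agrees_upto :: "'d \<Rightarrow> nat \<Rightarrow> 'd set \<Rightarrow> 'd set \<Rightarrow> bool" where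
  "agrees_upto q n T X \<longleftrightarrow>
     (\<forall>h\<in>D. fv T q h < n \<longrightarrow> fv T q h < fv T q (a h) \<longrightarrow> (h \<in> X \<longleftrightarrow> h \<in> T)) \<and>
     (\<forall>y\<in>T. fv T q y < n \<longrightarrow> fv T q y < fv T q (a y) \<longrightarrow>
        (\<exists>A. vert r y \<notin> A \<and> vert r (a y) \<in> A \<and>
          (\<forall>k\<in>X. fv T q y \<le> fv T q k \<longrightarrow> fv T q y \<le> fv T q (a k) \<longrightarrow> vert r k \<in> A \<longrightarrow> vert r (a k) \<in> A)))"

context
  fixes T q X n h
  assumes T: "spanning_tree D a r T" and q: "q \<in> D" and X: "orientation X"
    and agr: "agrees_upto q n T X"
    and h: "h \<in> D" "fv T q h = n" "n < fv T q (a h)"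
begin

abbreviation "visited \<equiv> {k \<in> D. fv T q k < n \<or> fv T q (a k) < n}"

lemma visited_a: "k \<in> D \<Longrightarrow> a k \<in> visited \<longleftrightarrow> k \<in> visited"
  by auto

lemma h_unvisited: "h \<notin> visited" "a h \<notin> visited"
  using h by auto

text \<open>Changes confined to unvisited edges keep the invariant at all earlier darts, so only the
  conditions at \<open>h\<close> itself remain to be supplied.\<close>

lemma extend_agreement:
  assumes T': "spanning_tree D a r T'" and X': "orientation X'" "heads X' = heads X"
    and same_T: "\<And>k. k \<in> visited \<Longrightarrow> k \<in> T \<longleftrightarrow> k \<in> T'"
    and same_X: "\<And>k. k \<in> visited \<Longrightarrow> k \<in> X \<longleftrightarrow> k \<in> X'"
    and h_iff: "h \<in> X' \<longleftrightarrow> h \<in> T'"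
    and cut: "h \<in> T' \<Longrightarrow> \<exists>A. vert r h \<notin> A \<and> vert r (a h) \<in> A \<and>
      (\<forall>k\<in>X'. k \<notin> visited \<longrightarrow> vert r k \<in> A \<longrightarrow> vert r (a k) \<in> A)"
  shows "agrees_upto q (Suc n) T' X'"
proof -
  have agree: "k \<in> T \<longleftrightarrow> k \<in> T'" if "k \<in> D" "fv T q k < n" for k
    using same_T that by simp
  have fv1: "fv T' q k = fv T q k" if "k \<in> D" "fv T q k \<le> n" for k
    by (rule fv_agree1[OF T T' q _ that]) (rule agree)
  have fv2: "fv T' q k = fv T q k" if "k \<in> D" "fv T' q k \<le> n" for k
    by (rule fv_agree2[OF T T' q _ that]) (rule agree)
  have less_iff: "fv T' q k < m \<longleftrightarrow> fv T q k < m" if "k \<in> D" "m \<le> n" for k m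
    using fv1[OF that(1)] fv2[OF that(1)] that(2) by (metis less_imp_le_nat order_less_le_trans)
  have first: "fv T q k < fv T q (a k)" "fv T q k = fv T' q k"
    if "k \<in> D" "fv T' q k \<le> n" "fv T' q k < fv T' q (a k)" for k
  proof -
    show eq: "fv T q k = fv T' q k" using fv2[OF that(1,2)] by simp
    show "fv T q k < fv T q (a k)"
      using less_iff[of "a k" "fv T' q k"] that eq
        fv_eq_iff[OF T q that(1) a_in[OF that(1)]] a_neq'[OF that(1)] by auto
  qed
  show ?thesis
    unfolding agrees_upto_def
  proof (intro conjI ballI impI)
    fix k assume k: "k \<in> D" "fv T' q k < Suc n" "fv T' q k < fv T' q (a k)"
    note f = first[of k]
    show "k \<in> X' \<longleftrightarrow> k \<in> T'"
    proof (cases "fv T q k = n")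
      case True
      then have "k = h" using fv_eq_iff[OF T q k(1) h(1)] h by simp
      then show ?thesis using h_iff by simp
    next
      case False
      then have "fv T q k < n" "fv T q k < fv T q (a k)" using f k by auto
      moreover from this have "k \<in> X \<longleftrightarrow> k \<in> T"
        using agr k unfolding agrees_upto_def by blast
      ultimately show ?thesis using same_T[of k] same_X[of k] k by simp
    qed
  next
    fix y assume y: "y \<in> T'" "fv T' q y < Suc n" "fv T' q y < fv T' q (a y)"
    have "y \<in> D" using TD(4)[OF T'] y by blast
    note f = first[of y]
    show "\<exists>A. vert r y \<notin> A \<and> vert r (a y) \<in> A \<and>
          (\<forall>k\<in>X'. fv T' q y \<le> fv T' q k \<longrightarrow> fv T' q y \<le> fv T' q (a k) \<longrightarrow> vert r k \<in> A \<longrightarrow> vert r (a k) \<in> A)"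
    proof (cases "fv T q y = n")
      case True
      then have "y = h" using fv_eq_iff[OF T q \<open>y \<in> D\<close> h(1)] h by simp
      then obtain A where A: "vert r y \<notin> A" "vert r (a y) \<in> A"
        "\<And>k. k \<in> X' \<Longrightarrow> k \<notin> visited \<Longrightarrow> vert r k \<in> A \<Longrightarrow> vert r (a k) \<in> A"
        using cut y by blast
      have "k \<notin> visited" if "k \<in> X'" "fv T' q y \<le> fv T' q k" "fv T' q y \<le> fv T' q (a k)" for k
        using less_iff[of k n] less_iff[of "a k" n] that orientationD(3)[OF X'(1)] True f y \<open>y \<in> D\<close> by auto
      then show ?thesis using A by blast
    next
      case False
      then have y_n: "fv T q y < n" "fv T q y < fv T q (a y)" "fv T q y = fv T' q y"
        using f[OF \<open>y \<in> D\<close> _ y(3)] y(2) False by simp_all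
      then have "y \<in> T" using agree \<open>y \<in> D\<close> y by blast
      then obtain A where A: "vert r y \<notin> A" "vert r (a y) \<in> A"
        "\<And>k. k \<in> X \<Longrightarrow> fv T q y \<le> fv T q k \<Longrightarrow> fv T q y \<le> fv T q (a k) \<Longrightarrow> vert r k \<in> A \<Longrightarrow> vert r (a k) \<in> A"
        using agr[unfolded agrees_upto_def, THEN conjunct2, rule_format, OF \<open>y \<in> T\<close> y_n(1,2)] by blast
      have "vert r (a k) \<in> A"
        if k: "k \<in> X'" "fv T' q y \<le> fv T' q k" "fv T' q y \<le> fv T' q (a k)" "vert r k \<in> A" for k
      proof (rule ccontr)
        assume out: "vert r (a k) \<notin> A"
        have "k \<in> D" using k orientationD(3)[OF X'(1)] by blast
        have ge: "fv T q y \<le> fv T q k" "fv T q y \<le> fv T q (a k)"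
          using less_iff[of k "fv T q y"] less_iff[of "a k" "fv T q y"] k \<open>k \<in> D\<close> y_n by auto
        then have "k \<notin> X" using A(3) k out by blast
        then have "a k \<in> X - X'"
          using orientationD(4)[OF X \<open>k \<in> D\<close>] orientationD(4)[OF X'(1) \<open>k \<in> D\<close>] k by blast
        \<comment> \<open>A new late arc out of \<open>A\<close> is the reversal of an arc entering
          \<open>A\<close>. Since the reversed arcs are balanced, one of them left \<open>A\<close>
          already in \<open>X\<close>; being unvisited, it contradicts the old cut.\<close>
        then obtain l where l: "l \<in> X - X'" "vert r l \<in> A" "vert r (a l) \<notin> A"
          using crossing_back[of "X - X'" "a k" A] heads_eq_balanced[OF X X'(1) X'(2)[symmetric], of A]
            out k(4) \<open>k \<in> D\<close> orientationD(2)[OF X] by auto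
        then have "l \<notin> visited" "l \<in> D" using same_X[of l] orientationD(3)[OF X, of l] by blast+
        then have "fv T q y \<le> fv T q l" "fv T q y \<le> fv T q (a l)" using y_n by auto
        then show False using A(3)[of l] l by blast
      qed
      then show ?thesis using A by blast
    qed
  qed
qed

text \<open>The greedy rule: cut through \<open>h\<close> whenever reorienting unvisited edges with
  the same indegrees can direct the edge of \<open>h\<close> towards the current vertex; otherwise
  walk along \<open>h\<close>. In both cases an exchange with an unvisited edge makes the tree
  follow the decision.\<close>

lemma extend_step:
  assumes root: "rooted X (vert r q)"
  shows "\<exists>T' X'. spanning_tree D a r T' \<and> orientation X' \<and> heads X' = heads X \<and> agrees_upto q (Suc n) T' X'"
proof (cases "\<exists>X'. orientation X' \<and> heads X' = heads X \<and> (\<forall>k\<in>visited. k \<in> X \<longleftrightarrow> k \<in> X') \<and> a h \<in> X'")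
  case True
  then obtain X' where X': "orientation X'" "heads X' = heads X"
    "\<And>k. k \<in> visited \<Longrightarrow> k \<in> X \<longleftrightarrow> k \<in> X'" "a h \<in> X'"
    by blast
  then have "h \<notin> X'" using orientationD(4)[OF X'(1) h(1)] by blast
  have "\<exists>T'. spanning_tree D a r T' \<and> h \<notin> T' \<and> (\<forall>k\<in>visited. k \<in> T \<longleftrightarrow> k \<in> T')"
  proof (cases "h \<in> T")
    case True
    let ?A = "tree_side T h"
    note cut = tree_cut_tree_side[OF T True]
    have "vert r q \<notin> ?A" using tree_cut_first[OF T q cut] h by simp
    note interval = tree_cut_interval[OF T q this cut]
    \<comment> \<open>The far side of \<open>h\<close> must still be entered by \<open>X'\<close>,
      and not along \<open>h\<close>. The entering arc \<open>k\<close> replaces \<open>h\<close>;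
      had it been visited, it would be the earlier dart of its edge and, by the invariant, a tree
      dart.\<close>
    have "rooted X' (vert r q)"
      using rooted_heads_eq[OF X X'(1) root] X'(2) by simp
    then obtain k where k: "k \<in> X'" "vert r k \<notin> ?A" "vert r (a k) \<in> ?A"
      using rootedE[of X' "vert r q" ?A "a h"] \<open>vert r q \<notin> ?A\<close> cut h unfolding tree_cut_def by auto
    have "k \<in> D" using orientationD(3)[OF X'(1) k(1)] .
    have "k \<noteq> h" "k \<noteq> a h" using k \<open>h \<notin> X'\<close> cut unfolding tree_cut_def by auto
    then have "k \<notin> T" using cut k unfolding tree_cut_def by blast
    have "k \<notin> visited"
    proof
      assume vis: "k \<in> visited"
      have "n < fv T q (a k)" using interval[of "a k"] k \<open>k \<in> D\<close> h by simp
      then have "fv T q k < n" "fv T q k < fv T q (a k)" using vis by auto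
      then have "k \<in> X \<longleftrightarrow> k \<in> T" using agr \<open>k \<in> D\<close> unfolding agrees_upto_def by blast
      then show False using X'(3)[OF vis] k \<open>k \<notin> T\<close> by blast
    qed
    let ?T = "T - edge_of a h \<union> edge_of a k"
    have "spanning_tree D a r ?T"
      by (rule tree_exchange[OF T True \<open>k \<in> D\<close> k(2,3) \<open>k \<notin> T\<close>])
    moreover have "h \<notin> ?T"
      using \<open>k \<noteq> h\<close> \<open>k \<noteq> a h\<close> a_a[OF \<open>k \<in> D\<close>] unfolding edge_of_def by auto
    moreover have "k \<notin> visited" "a k \<notin> visited" "h \<notin> visited" "a h \<notin> visited"
      using \<open>k \<notin> visited\<close> visited_a[OF \<open>k \<in> D\<close>] h_unvisited by blast+
    then have "\<forall>l\<in>visited. l \<in> T \<longleftrightarrow> l \<in> ?T"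
      unfolding edge_of_def by blast
    ultimately show ?thesis by blast
  qed (use T in blast)
  then obtain T' where "spanning_tree D a r T'" "h \<notin> T'" "\<And>k. k \<in> visited \<Longrightarrow> k \<in> T \<longleftrightarrow> k \<in> T'"
    by blast
  then have "agrees_upto q (Suc n) T' X'"
    using X' \<open>h \<notin> X'\<close> by (intro extend_agreement) auto
  then show ?thesis using X' \<open>spanning_tree D a r T'\<close> by blast
next
  case no_flip: False
  have "h \<in> X"
    using no_flip X orientationD(4)[OF X h(1)] by blast
  let ?S = "{k \<in> X. k \<notin> visited \<and> k \<noteq> h}"
  \<comment> \<open>If the tail of \<open>h\<close> were reachable from its head through unvisited
    arcs, reversing the resulting cycle would reverse \<open>h\<close> and keep the indegrees. So
    the reachable set is the cut demanded for \<open>h\<close>.\<close>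
  define A where "A = {x. (vert r (a h), x) \<in> (link a r ?S)\<^sup>*}"
  have "vert r h \<notin> A"
  proof
    assume "vert r h \<in> A"
    then have "(vert r (a h), vert r h) \<in> (link a r ?S)\<^sup>*" unfolding A_def by simp
    moreover have "finite ?S" using orientationD(2)[OF X] by simp
    ultimately obtain S where S: "S \<subseteq> ?S"
      "\<And>g :: 'd set \<Rightarrow> int. (\<Sum>k\<in>S. g (vert r (a k)) - g (vert r k)) = g (vert r h) - g (vert r (a h))"
      using path_set[of ?S "vert r (a h)" "vert r h"] by blast
    have "finite S" using S(1) \<open>finite ?S\<close> finite_subset by blast
    have "h \<notin> S" using S(1) by auto
    let ?X = "flip X (insert h S)"
    have sub: "insert h S \<subseteq> X" using S(1) \<open>h \<in> X\<close> by auto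
    have "heads X x - heads ?X x = 0" for x
      unfolding heads_flip[OF X sub]
      using S(2)[of "\<lambda>y. of_bool (y = x)"] \<open>finite S\<close> \<open>h \<notin> S\<close> by simp
    then have "heads ?X = heads X" by (intro ext) (metis eq_iff_diff_eq_0)
    moreover have "\<forall>k\<in>visited. k \<in> X \<longleftrightarrow> k \<in> ?X"
    proof
      fix k assume k: "k \<in> visited"
      then have "k \<in> D" by simp
      have "k \<notin> insert h S" "a k \<notin> insert h S"
        using k S(1) visited_a[OF \<open>k \<in> D\<close>] h_unvisited by blast+
      then show "k \<in> X \<longleftrightarrow> k \<in> ?X" using in_flip[OF X sub \<open>k \<in> D\<close>] by blast
    qed
    moreover have "a h \<in> ?X" using in_flip[OF X sub a_in[OF h(1)]] h(1) by simp
    ultimately show False using no_flip orientation_flip[OF X sub] by blast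
  qed
  moreover have "vert r (a h) \<in> A" unfolding A_def by simp
  moreover have "vert r (a k) \<in> A" if "k \<in> X" "k \<notin> visited" "vert r k \<in> A" for k
  proof -
    have "k \<noteq> h" using that \<open>vert r h \<notin> A\<close> by blast
    then have "(vert r k, vert r (a k)) \<in> link a r ?S" using that unfolding link_def by blast
    then show ?thesis using that(3) unfolding A_def by (auto intro: rtrancl_into_rtrancl)
  qed
  ultimately have cut_h: "\<exists>A. vert r h \<notin> A \<and> vert r (a h) \<in> A \<and>
      (\<forall>k\<in>X. k \<notin> visited \<longrightarrow> vert r k \<in> A \<longrightarrow> vert r (a k) \<in> A)"
    and no_loop: "vert r h \<noteq> vert r (a h)"
    by (blast, metis)
  have "\<exists>T'. spanning_tree D a r T' \<and> h \<in> T' \<and> (\<forall>k\<in>visited. k \<in> T \<longleftrightarrow> k \<in> T')"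
  proof (cases "h \<in> T")
    case False
    let ?cross = "\<lambda>f. vert r h \<in> tree_side T f \<longleftrightarrow> vert r (a h) \<notin> tree_side T f"
    \<comment> \<open>The tree edges with \<open>?cross\<close> form the tree path between the ends
      of \<open>h\<close>. If all were visited, the interval property would direct them from the
      head of \<open>h\<close> to its tail and the invariant would put them in \<open>X\<close>.
      With \<open>h\<close> they would close a directed cycle, which the cut of its earliest tree
      dart \<open>y\<close> forbids.\<close>
    have "\<exists>f\<in>arcs T q. ?cross f \<and> f \<notin> visited"
    proof (rule ccontr)
      assume "\<not> ?thesis"
      then have vis: "f \<in> visited" if "f \<in> arcs T q" "?cross f" for f
        using that by blast
      have arc_D: "f \<in> D" if "f \<in> arcs T q" for f using that TD(4)[OF T] by blast
      let ?P = "{f \<in> arcs T q. ?cross f}"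
      have P: "fv T q f < n" "vert r h \<in> tree_side T f" "vert r (a h) \<notin> tree_side T f"
        if f: "f \<in> ?P" for f
      proof -
        have "f \<in> T" "fv T q f < fv T q (a f)" "?cross f" using f by auto
        note cut = tree_cut_tree_side[OF T \<open>f \<in> T\<close>]
        show "fv T q f < n" using vis[of f] f by auto
        have "vert r q \<notin> tree_side T f"
          using tree_cut_first[OF T q cut] \<open>fv T q f < fv T q (a f)\<close> by simp
        note interval = tree_cut_interval[OF T q this cut]
        show "vert r h \<in> tree_side T f"
        proof (rule ccontr)
          assume "vert r h \<notin> tree_side T f"
          then show False
            using interval[OF h(1)] interval[OF a_in[OF h(1)]] \<open>?cross f\<close> \<open>fv T q f < n\<close> h by auto
        qed
        then show "vert r (a h) \<notin> tree_side T f" using \<open>?cross f\<close> by blast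
      qed
      have P_sum: "(\<Sum>p\<in>?P. g (vert r (a p)) - g (vert r p)) = g (vert r h) - g (vert r (a h))"
        for g :: "'d set \<Rightarrow> int"
      proof -
        let ?w = "\<lambda>p. g (vert r (a p)) - g (vert r p)"
        have "g (vert r h) - g (vert r (a h)) = potential T q ?w (vert r h) - potential T q ?w (vert r (a h))"
          using potential_exact[OF T q h(1), of g] potential_exact[OF T q a_in[OF h(1)], of g] by simp
        also have "\<dots> = (\<Sum>p\<in>arcs T q. if ?cross p then ?w p else 0)"
          unfolding potential_def[OF T q] sum_subtractf[symmetric]
        proof (rule sum.cong[OF refl])
          fix p assume p: "p \<in> arcs T q"
          show "of_bool (vert r h \<in> tree_side T p) * ?w p - of_bool (vert r (a h) \<in> tree_side T p) * ?w p
            = (if ?cross p then ?w p else 0)"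
          proof (cases "?cross p")
            case True
            then have "p \<in> ?P" using p by blast
            from P(2,3)[OF this] show ?thesis using True by simp
          next
            case False
            then have "vert r h \<in> tree_side T p \<longleftrightarrow> vert r (a h) \<in> tree_side T p" by blast
            then show ?thesis using False by simp
          qed
        qed
        also have "\<dots> = (\<Sum>p\<in>?P. ?w p)"
          using sum.inter_filter[OF finite_arcs[OF T q], of ?w ?cross] by simp
        finally show ?thesis by simp
      qed
      have finP: "finite ?P" using finite_arcs[OF T q] by (rule rev_finite_subset) blast
      have "?P \<noteq> {}"
      proof
        assume empty: "?P = {}"
        show False
          using P_sum[of "\<lambda>x. of_bool (x = vert r h)"] no_loop unfolding empty by simp
      qed
      then obtain p0 where "p0 \<in> ?P" by blast
      define y where "y = arg_min_on (fv T q) ?P"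
      have y: "y \<in> ?P"
        unfolding y_def by (rule arg_min_if_finite(1)[OF finP]) (use \<open>p0 \<in> ?P\<close> in blast)
      have min: "fv T q y \<le> fv T q p" if "p \<in> ?P" for p
        unfolding y_def by (rule arg_min_least[OF finP _ that]) (use that in blast)
      have "y \<in> T" "fv T q y < fv T q (a y)" using y by auto
      then obtain A where A: "vert r y \<notin> A" "vert r (a y) \<in> A"
        "\<And>k. k \<in> X \<Longrightarrow> fv T q y \<le> fv T q k \<Longrightarrow> fv T q y \<le> fv T q (a k) \<Longrightarrow> vert r k \<in> A \<Longrightarrow> vert r (a k) \<in> A"
        using agr[unfolded agrees_upto_def, THEN conjunct2, rule_format, OF _ P(1)[OF y]] by blast
      have "h \<notin> ?P" using \<open>h \<notin> T\<close> by simp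
      then have "(\<Sum>k\<in>insert h ?P. of_bool (vert r (a k) \<in> A) - of_bool (vert r k \<in> A)) = (0::int)"
        using P_sum[of "\<lambda>x. of_bool (x \<in> A)"] finP by simp
      then obtain k where k: "k \<in> insert h ?P" "vert r k \<in> A" "vert r (a k) \<notin> A"
        using crossing_back[of "insert h ?P" y A] finP y A(1,2) by auto
      have "k \<in> X \<and> fv T q y \<le> fv T q k \<and> fv T q y \<le> fv T q (a k)"
      proof (cases "k = h")
        case True
        then show ?thesis using \<open>h \<in> X\<close> P(1)[OF y] h by simp
      next
        case False
        then have "k \<in> ?P" using k by blast
        then have "k \<in> X"
          using agr P(1)[of k] arc_D unfolding agrees_upto_def by blast
        then show ?thesis using min[OF \<open>k \<in> ?P\<close>] \<open>k \<in> ?P\<close> by auto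
      qed
      then show False using A(3) k by blast
    qed
    then obtain f where f: "f \<in> T" "?cross f" "f \<notin> visited" by blast
    have "f \<in> D" using TD(4)[OF T f(1)] .
    let ?T = "T - edge_of a f \<union> edge_of a h"
    have "edge_of a (a h) = edge_of a h" using h(1) unfolding edge_of_def by auto
    moreover have "a h \<notin> T" using TD(5)[OF T h(1)] False by simp
    ultimately have "spanning_tree D a r ?T"
      using tree_exchange[OF T f(1) h(1) _ _ False] tree_exchange[OF T f(1) a_in[OF h(1)]] f(2) h(1)
      by (cases "vert r h \<in> tree_side T f") auto
    moreover have "f \<notin> visited" "a f \<notin> visited" "h \<notin> visited" "a h \<notin> visited"
      using f(3) visited_a[OF \<open>f \<in> D\<close>] h_unvisited by blast+
    then have "\<forall>l\<in>visited. l \<in> T \<longleftrightarrow> l \<in> ?T"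
      unfolding edge_of_def by blast
    moreover have "h \<in> ?T" unfolding edge_of_def by blast
    ultimately show ?thesis by blast
  qed (use T in blast)
  then obtain T' where T': "spanning_tree D a r T'" "h \<in> T'" "\<And>k. k \<in> visited \<Longrightarrow> k \<in> T \<longleftrightarrow> k \<in> T'"
    by blast
  then have "agrees_upto q (Suc n) T' X"
    using X \<open>h \<in> X\<close> cut_h by (intro extend_agreement) auto
  then show ?thesis using X T' by blast
qed

end

lemma bern_orient_surj:
  assumes X: "orientation X" and root: "rooted X (vert r q)" and q: "q \<in> D"
  obtains T where "spanning_tree D a r T" "heads (bern_orient q T) = heads X"
proof -
  have "\<exists>T X'. spanning_tree D a r T \<and> orientation X' \<and> heads X' = heads X \<and> agrees_upto q n T X'"
    if "n \<le> card D" for n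
    using that
  proof (induction n)
    case 0
    obtain T where "spanning_tree D a r T"
      using connected_contains_tree[of D] connected by auto
    then show ?case using X unfolding agrees_upto_def by auto
  next
    case (Suc n)
    then obtain T X' where IH: "spanning_tree D a r T" "orientation X'" "heads X' = heads X"
      "agrees_upto q n T X'" by auto
    have root': "rooted X' (vert r q)"
      using rooted_heads_eq[OF X IH(2) root] IH(3) by simp
    have "n \<in> fv T q ` D" using fv_image[OF IH(1) q] Suc.prems by auto
    then obtain h where h: "h \<in> D" "fv T q h = n" by blast
    show ?case
    proof (cases "n < fv T q (a h)")
      case True
      then show ?thesis
        using extend_step[OF IH(1) q IH(2,4) h True root'] IH(3) by metis
    next
      case False
      \<comment> \<open>The edge of \<open>h\<close> was settled when \<open>a h\<close> was
        visited, so time \<open>n\<close> adds no condition.\<close>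
      have only_h: "k = h" if "k \<in> D" "fv T q k = n" for k
        using fv_eq_iff[OF IH(1) q that(1) h(1)] that h by simp
      have "agrees_upto q (Suc n) T X'"
        unfolding agrees_upto_def
      proof (intro conjI ballI impI)
        fix k assume k: "k \<in> D" "fv T q k < Suc n" "fv T q k < fv T q (a k)"
        then have "fv T q k < n" using False h only_h[of k] by force
        then show "k \<in> X' \<longleftrightarrow> k \<in> T" using k IH(4) unfolding agrees_upto_def by blast
      next
        fix y assume y: "y \<in> T" "fv T q y < Suc n" "fv T q y < fv T q (a y)"
        then have "fv T q y < n" using False h only_h[of y] TD(4)[OF IH(1)] by force
        then show "\<exists>A. vert r y \<notin> A \<and> vert r (a y) \<in> A \<and>
          (\<forall>k\<in>X'. fv T q y \<le> fv T q k \<longrightarrow> fv T q y \<le> fv T q (a k) \<longrightarrow> vert r k \<in> A \<longrightarrow> vert r (a k) \<in> A)"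
          using y IH(4) unfolding agrees_upto_def by blast
      qed
      then show ?thesis using IH by blast
    qed
  qed
  from this[of "card D"] obtain T X' where T: "spanning_tree D a r T" and X': "orientation X'"
    "heads X' = heads X" "agrees_upto q (card D) T X'" by blast
  have less: "fv T q k < card D" if "k \<in> D" for k
    using fv_image[OF T q] that by blast
  have first: "k \<in> X' \<longleftrightarrow> k \<in> T" if "k \<in> D" "fv T q k < fv T q (a k)" for k
    using X'(3) less that unfolding agrees_upto_def by blast
  have "X' = bern_orient q T"
  proof (intro set_eqI)
    fix k
    show "k \<in> X' \<longleftrightarrow> k \<in> bern_orient q T"
    proof (cases "k \<in> D")
      case True
      then show ?thesis
        using first[of k] first[of "a k"] in_bern_orient[OF T q True] fv_total[OF T q True]
          orientationD(4)[OF X'(1) True] TD(5)[OF T True] by auto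
    next
      case False
      then show ?thesis
        using orientationD(3)[OF X'(1)] orientationD(3)[OF orientation_bern_orient[OF T q]] by blast
    qed
  qed
  then show thesis using that T X'(2) by simp
qed

subsection \<open>Every class contains the divisor of a rooted orientation\<close>

lemma laplacian_alt:
  "laplacian D a r f x = (\<Sum>h\<in>D. (f (vert r h) - f (vert r (a h))) * of_bool (vert r h = x))"
  unfolding laplacian_def by (rule sum.mono_neutral_cong_left) auto

lemma principalI:
  assumes "\<And>x. E x = (\<Sum>h\<in>D. \<delta> h * of_bool (vert r h = x))"
    and "\<And>h. h \<in> D \<Longrightarrow> \<delta> h = f (vert r h) - f (vert r (a h))"
  shows "principal E"
  unfolding principal_def laplacian_alt using assms by (intro exI[of _ f]) simp

lemma sum_a: "(\<Sum>h\<in>D. G (a h)) = (\<Sum>h\<in>D. G h)" for G :: "'d \<Rightarrow> int"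
  by (rule sum.reindex_bij_witness[of _ a a]) auto

lemma sum_subset_of_bool:
  "S \<subseteq> D \<Longrightarrow> (\<Sum>h\<in>S. G h) = (\<Sum>h\<in>D. of_bool (h \<in> S) * G h)" for G :: "'d \<Rightarrow> int"
  by (rule sum.mono_neutral_cong_left) auto

lemma reach_rooted:
  assumes reach: "\<And>k. k \<in> D \<Longrightarrow> (w, vert r k) \<in> (link a r X)\<^sup>*"
  shows "rooted X w"
  unfolding rooted_def
proof (intro allI impI)
  fix A assume w: "w \<notin> A" and "\<exists>h\<in>D. vert r h \<in> A"
  then obtain h where h: "h \<in> D" "vert r h \<in> A" by blast
  have "x \<in> A \<longrightarrow> (\<exists>k\<in>X. vert r k \<notin> A \<and> vert r (a k) \<in> A)" if "(w, x) \<in> (link a r X)\<^sup>*" for x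
    using that
  proof induction
    case (step y z)
    then show ?case unfolding link_def by auto
  qed (use w in simp)
  then show "\<exists>k\<in>X. vert r k \<notin> A \<and> vert r (a k) \<in> A" using reach h by blast
qed

lemma rooted_reach:
  assumes "rooted X w" "k \<in> D"
  shows "(w, vert r k) \<in> (link a r X)\<^sup>*"
proof (rule ccontr)
  assume out: "(w, vert r k) \<notin> (link a r X)\<^sup>*"
  let ?A = "- {x. (w, x) \<in> (link a r X)\<^sup>*}"
  obtain l where l: "l \<in> X" "vert r l \<notin> ?A" "vert r (a l) \<in> ?A"
    using rootedE[OF assms(1), of ?A k] out assms(2) by auto
  then have "(w, vert r l) \<in> (link a r X)\<^sup>*" "(vert r l, vert r (a l)) \<in> link a r X"
    unfolding link_def by auto
  then have "(w, vert r (a l)) \<in> (link a r X)\<^sup>*" by (rule rtrancl_into_rtrancl)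
  then show False using l by simp
qed

text \<open>Every arc between the reachable set \<open>A\<close> and the rest points into
  \<open>A\<close>. Reversing all of them changes indegrees by the Laplacian of the indicator of
  \<open>A\<close>, keeps everything reached so far, and by connectedness reaches a new
  vertex.\<close>

lemma equivalent_rooted:
  assumes "orientation X" and w: "w \<in> verts D r"
  shows "\<exists>Y. orientation Y \<and> rooted Y w \<and> principal (\<lambda>x. heads X x - heads Y x)"
  using assms(1)
proof (induction "card {k \<in> D. (w, vert r k) \<notin> (link a r X)\<^sup>*}" arbitrary: X rule: less_induct)
  case (less X)
  note X = \<open>orientation X\<close>
  define A where "A = {x. (w, x) \<in> (link a r X)\<^sup>*}"
  show ?case
  proof (cases "\<forall>k\<in>D. vert r k \<in> A")
    case True
    then have "rooted X w" unfolding A_def by (intro reach_rooted) auto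
    then show ?thesis using X principal_zero by (intro exI[of _ X]) simp
  next
    case False
    have stay: "vert r (a k) \<in> A" if "k \<in> X" "vert r k \<in> A" for k
    proof -
      have "(vert r k, vert r (a k)) \<in> link a r X" using that unfolding link_def by blast
      then show ?thesis using that(2) unfolding A_def by (auto intro: rtrancl_into_rtrancl)
    qed
    define S where "S = {k \<in> X. vert r k \<notin> A \<and> vert r (a k) \<in> A}"
    define Y where "Y = flip X S"
    have S: "S \<subseteq> X" "S \<subseteq> D" using orientationD(1)[OF X] unfolding S_def by auto
    have S_iff: "of_bool (a h \<in> S) - of_bool (h \<in> S) = of_bool (vert r h \<in> A) - (of_bool (vert r (a h) \<in> A) :: int)"
      if "h \<in> D" for h
      using that stay[of h] stay[of "a h"] orientationD(4)[OF X that] unfolding S_def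
      by (cases "h \<in> X") auto
    have "heads X x - heads Y x = (\<Sum>h\<in>D. (of_bool (a h \<in> S) - of_bool (h \<in> S)) * of_bool (vert r h = x))" for x
    proof -
      have "heads X x - heads Y x = (\<Sum>h\<in>D. of_bool (h \<in> S) * of_bool (vert r (a h) = x))
          - (\<Sum>h\<in>D. of_bool (h \<in> S) * of_bool (vert r h = x))"
        unfolding Y_def heads_flip[OF X S(1)] sum_subset_of_bool[OF S(2)]
        by (simp add: right_diff_distrib sum_subtractf)
      also have "(\<Sum>h\<in>D. of_bool (h \<in> S) * of_bool (vert r (a h) = x))
          = (\<Sum>h\<in>D. of_bool (a h \<in> S) * of_bool (vert r h = x) :: int)"
        using sum_a[of "\<lambda>h. of_bool (a h \<in> S) * of_bool (vert r h = x)"] by simp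
      finally show ?thesis by (simp add: left_diff_distrib sum_subtractf)
    qed
    then have prin: "principal (\<lambda>x. heads X x - heads Y x)"
      by (rule principalI[where f = "\<lambda>x. of_bool (x \<in> A)"]) (rule S_iff)
    have Y: "orientation Y" unfolding Y_def by (rule orientation_flip[OF X S(1)])
    have mono: "(w, x) \<in> (link a r Y)\<^sup>*" if "(w, x) \<in> (link a r X)\<^sup>*" for x
      using that
    proof induction
      case (step y z)
      obtain k where k: "k \<in> X" "y = vert r k" "z = vert r (a k)"
        using step.hyps(2) unfolding link_def by blast
      have "k \<notin> S" using step.hyps(1) k unfolding S_def A_def by simp
      then have "(y, z) \<in> link a r Y"
        using k unfolding link_def Y_def flip_def by blast
      then show ?case by (rule rtrancl_into_rtrancl[OF step.IH])
    qed simp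
    have "\<exists>l\<in>D. vert r l \<in> A \<and> vert r (a l) \<notin> A"
    proof (rule ccontr)
      assume none: "\<not> ?thesis"
      have cross: "vert r h \<in> A \<longleftrightarrow> vert r (a h) \<in> A" if "h \<in> D" for h
      proof -
        have "vert r (a h) \<in> A \<Longrightarrow> vert r (a (a h)) \<in> A" "vert r h \<in> A \<Longrightarrow> vert r (a h) \<in> A"
          using none that a_in[OF that] by blast+
        then show ?thesis unfolding a_a[OF that] by blast
      qed
      have same: "vert r h \<in> A \<longleftrightarrow> vert r k \<in> A" if "h \<in> D" "k \<in> D" for h k
        by (rule connected_const[OF connected, where G = "\<lambda>x. x \<in> A", OF cross that])
      have "w \<in> A" unfolding A_def by simp
      moreover obtain h where "h \<in> D" "w = vert r h" using w by (auto elim: vertsE)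
      ultimately show False using same[of h] False by blast
    qed
    then obtain l where l: "l \<in> D" "vert r l \<in> A" "vert r (a l) \<notin> A"
      by blast
    have "a l \<in> S"
      using l stay[of l] orientationD(4)[OF X l(1)] unfolding S_def by auto
    then have "(vert r l, vert r (a l)) \<in> link a r Y"
      using in_flip[OF X S(1) l(1)] unfolding link_def Y_def by blast
    then have new: "(w, vert r (a l)) \<in> (link a r Y)\<^sup>*"
      using mono l(2) unfolding A_def by (blast intro: rtrancl_into_rtrancl)
    have "card {k \<in> D. (w, vert r k) \<notin> (link a r Y)\<^sup>*} < card {k \<in> D. (w, vert r k) \<notin> (link a r X)\<^sup>*}"
    proof (rule psubset_card_mono)
      have "a l \<in> {k \<in> D. (w, vert r k) \<notin> (link a r X)\<^sup>*}" using l unfolding A_def by simp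
      moreover have "a l \<notin> {k \<in> D. (w, vert r k) \<notin> (link a r Y)\<^sup>*}" using new by simp
      ultimately show "{k \<in> D. (w, vert r k) \<notin> (link a r Y)\<^sup>*} \<subset> {k \<in> D. (w, vert r k) \<notin> (link a r X)\<^sup>*}"
        using mono by blast
    qed simp
    from less.hyps[OF this Y] obtain Z where Z: "orientation Z" "rooted Z w"
      "principal (\<lambda>x. heads Y x - heads Z x)" by blast
    then show ?thesis using principal_add[OF prin Z(3)] by (intro exI[of _ Z]) simp
  qed
qed

text \<open>Reversing a directed path from \<open>x\<close> to \<open>y\<close> moves the root to
  \<open>y\<close>; indegree plus the unit at the root stays the same.\<close>

lemma move_root:
  assumes X: "orientation X" "rooted X x" and y: "y \<in> verts D r"
  obtains Y where "orientation Y" "rooted Y y"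
    "\<And>z. heads Y z = heads X z + of_bool (x = z) - of_bool (y = z)"
proof -
  have "(x, y) \<in> (link a r X)\<^sup>*"
    using rooted_reach[OF X(2)] y by (auto elim: vertsE)
  then obtain S where S: "S \<subseteq> X"
    "\<And>g :: 'd set \<Rightarrow> int. (\<Sum>h\<in>S. g (vert r (a h)) - g (vert r h)) = g y - g x"
    using path_set[OF orientationD(2)[OF X(1)]] by blast
  let ?Y = "flip X S"
  have Y: "orientation ?Y" by (rule orientation_flip[OF X(1) S(1)])
  have "rooted ?Y y"
    by (rule rooted_transfer[OF X(1) Y X(2)]) (unfold minus_flip[OF X(1) S(1)], rule S(2))
  moreover have "heads ?Y z = heads X z + of_bool (x = z) - of_bool (y = z)" for z
    using heads_flip[OF X(1) S(1), of z] S(2)[of "\<lambda>u. of_bool (u = z)"] by simp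
  ultimately show thesis using that Y by blast
qed

text \<open>Says that adding \<open>E\<close> never leads out of the classes represented by
  orientations rooted at \<open>x0\<close>. Closure under sums reduces existence for an arbitrary
  boundary to single edges.\<close>

definition reachable_shift :: "'d set \<Rightarrow> ('d set \<Rightarrow> int) \<Rightarrow> bool" where
  "reachable_shift x0 E \<longleftrightarrow> (\<forall>X. orientation X \<longrightarrow> rooted X x0 \<longrightarrow>
     (\<exists>Y. orientation Y \<and> rooted Y x0 \<and> principal (\<lambda>x. heads Y x - heads X x - E x)))"

lemma reachable_shift_zero: "reachable_shift x0 (\<lambda>x. 0)"
  unfolding reachable_shift_def using principal_zero by auto

lemma reachable_shift_add:
  assumes E: "reachable_shift x0 E" and F: "reachable_shift x0 F"
  shows "reachable_shift x0 (\<lambda>x. E x + F x)"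
  unfolding reachable_shift_def
proof (intro allI impI)
  fix X assume "orientation X" "rooted X x0"
  then obtain Y where Y: "orientation Y" "rooted Y x0" "principal (\<lambda>x. heads Y x - heads X x - E x)"
    using E unfolding reachable_shift_def by blast
  then obtain Z where Z: "orientation Z" "rooted Z x0" "principal (\<lambda>x. heads Z x - heads Y x - F x)"
    using F unfolding reachable_shift_def by blast
  have "principal (\<lambda>x. heads Z x - heads X x - (E x + F x))"
    using principal_add[OF Y(3) Z(3)] by (simp add: algebra_simps)
  then show "\<exists>Y. orientation Y \<and> rooted Y x0 \<and> principal (\<lambda>x. heads Y x - heads X x - (E x + F x))"
    using Z by blast
qed

text \<open>Moving the root from \<open>x0\<close> to \<open>y\<close> adds \<open>x0\<close> minus
  \<open>y\<close>; an equivalent orientation rooted at \<open>z\<close> replaces the result; moving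
  the root back to \<open>x0\<close> adds \<open>z\<close> minus \<open>x0\<close>.\<close>

lemma reachable_shift_edge:
  assumes x0: "x0 \<in> verts D r" and y: "y \<in> verts D r" and z: "z \<in> verts D r"
  shows "reachable_shift x0 (\<lambda>x. of_bool (z = x) - of_bool (y = x))"
  unfolding reachable_shift_def
proof (intro allI impI)
  fix X assume X: "orientation X" "rooted X x0"
  obtain X1 where X1: "orientation X1" "rooted X1 y"
    "\<And>x. heads X1 x = heads X x + of_bool (x0 = x) - of_bool (y = x)"
    using move_root[OF X y] by blast
  obtain X2 where X2: "orientation X2" "rooted X2 z" "principal (\<lambda>x. heads X1 x - heads X2 x)"
    using equivalent_rooted[OF X1(1) z] by blast
  obtain Y where Y: "orientation Y" "rooted Y x0"
    "\<And>x. heads Y x = heads X2 x + of_bool (z = x) - of_bool (x0 = x)"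
    using move_root[OF X2(1,2) x0] by blast
  have "principal (\<lambda>x. heads Y x - heads X x - (of_bool (z = x) - of_bool (y = x)))"
    using principal_uminus[OF X2(3)] unfolding Y(3) X1(3) by (simp add: algebra_simps)
  then show "\<exists>Y. orientation Y \<and> rooted Y x0 \<and>
      principal (\<lambda>x. heads Y x - heads X x - (of_bool (z = x) - of_bool (y = x)))"
    using Y by blast
qed

lemma reachable_shift_of_nat:
  assumes "reachable_shift x0 E"
  shows "reachable_shift x0 (\<lambda>x. int m * E x)"
  by (induction m) (use reachable_shift_zero reachable_shift_add[OF assms] in \<open>simp_all add: distrib_right\<close>)

lemma reachable_shift_times:
  assumes "reachable_shift x0 E" "reachable_shift x0 (\<lambda>x. - E x)"
  shows "reachable_shift x0 (\<lambda>x. n * E x)"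
proof (cases "0 \<le> n")
  case True
  then show ?thesis using reachable_shift_of_nat[OF assms(1), of "nat n"] by simp
next
  case False
  then show ?thesis using reachable_shift_of_nat[OF assms(2), of "nat (- n)"] by simp
qed

lemma reachable_shift_boundary:
  assumes x0: "x0 \<in> verts D r"
  shows "reachable_shift x0 (boundary D a r c)"
proof -
  have "reachable_shift x0 (\<lambda>x. \<Sum>h\<in>S. c h * (of_bool (vert r (a h) = x) - of_bool (vert r h = x)))"
    if "finite S" "S \<subseteq> D" for S
    using that
  proof (induction S rule: finite_induct)
    case empty
    then show ?case using reachable_shift_zero by simp
  next
    case (insert h S)
    then have h: "vert r h \<in> verts D r" "vert r (a h) \<in> verts D r" by auto
    have "reachable_shift x0 (\<lambda>x. c h * (of_bool (vert r (a h) = x) - of_bool (vert r h = x)))"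
      by (rule reachable_shift_times)
        (use reachable_shift_edge[OF x0 h] reachable_shift_edge[OF x0 h(2,1)] in simp_all)
    then show ?case
      using insert by (simp add: reachable_shift_add)
  qed
  from this[of D] show ?thesis
    unfolding boundary_def of_bool_def by simp
qed

section \<open>The Bernardi action is well defined\<close>

lemma bernardi_exists:
  assumes T: "spanning_tree D a r T" and q: "q \<in> D"
  obtains T' where "spanning_tree D a r T'"
    "principal (\<lambda>x. bernardi D a r q T' x - bernardi D a r q T x - boundary D a r c x)"
proof -
  obtain Y where Y: "orientation Y" "rooted Y (vert r q)"
    "principal (\<lambda>x. heads Y x - heads (bern_orient q T) x - boundary D a r c x)"
    using reachable_shift_boundary[OF vert_in_verts[OF q], of c] orientation_bern_orient[OF T q]
      rooted_bern_orient[OF T q] unfolding reachable_shift_def by blast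
  obtain T' where T': "spanning_tree D a r T'" "heads (bern_orient q T') = heads Y"
    using bern_orient_surj[OF Y(1,2) q] by blast
  have "principal (\<lambda>x. bernardi D a r q T' x - bernardi D a r q T x - boundary D a r c x)"
    unfolding bernardi_eq_heads[OF T q] bernardi_eq_heads[OF T'(1) q] T'(2)
    using Y(3) by (simp add: algebra_simps)
  then show thesis using that T'(1) by blast
qed

lemma break_divisor_unique:
  assumes "B \<in> break_divisors D a r" "B' \<in> break_divisors D a r"
    and "principal (\<lambda>x. B x - B' x)" and q: "q \<in> D"
  shows "B = B'"
proof -
  obtain X where X: "orientation X" "rooted X (vert r q)"
    "\<And>x. B x = heads X x - of_bool (x \<in> verts D r) + of_bool (x = vert r q)"
    using break_divisor_heads[OF assms(1) q] by blast
  obtain Y where Y: "orientation Y" "rooted Y (vert r q)"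
    "\<And>x. B' x = heads Y x - of_bool (x \<in> verts D r) + of_bool (x = vert r q)"
    using break_divisor_heads[OF assms(2) q] by blast
  have "principal (\<lambda>x. heads X x - heads Y x)"
    using assms(3) unfolding X(3) Y(3) by simp
  then have "heads X = heads Y"
    using rooted_heads_unique[OF X(1,2) Y(1,2)] q by simp
  then show ?thesis using X(3) Y(3) by auto
qed

text \<open>Evaluates both definite descriptions: uniqueness of break divisors settles the inner
  one, injectivity of the Bernardi map the outer one.\<close>

lemma bernardi_action_eqI:
  assumes T: "spanning_tree D a r T" and T': "spanning_tree D a r T'" and q: "q \<in> D"
    and prin: "principal (\<lambda>x. bernardi D a r q T' x - bernardi D a r q T x - \<gamma> x)"
  shows "bernardi_action D a r q \<gamma> T = T'"
proof -
  have act: "break_act D a r \<gamma> (bernardi D a r q T) = bernardi D a r q T'"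
    unfolding break_act_def
  proof (rule the_equality)
    show "bernardi D a r q T' \<in> break_divisors D a r \<and>
        lin_equiv D a r (bernardi D a r q T') (\<lambda>x. bernardi D a r q T x + \<gamma> x)"
      using prin bernardi_break_divisor[OF T' q] unfolding lin_equiv_iff_principal
      by (simp add: algebra_simps)
    fix B assume B: "B \<in> break_divisors D a r \<and> lin_equiv D a r B (\<lambda>x. bernardi D a r q T x + \<gamma> x)"
    then have "principal (\<lambda>x. B x - (bernardi D a r q T x + \<gamma> x))"
      unfolding lin_equiv_iff_principal by blast
    from principal_diff[OF this prin] have "principal (\<lambda>x. B x - bernardi D a r q T' x)"
      by (simp add: algebra_simps)
    then show "B = bernardi D a r q T'"
      using B bernardi_break_divisor[OF T' q] q by (intro break_divisor_unique) auto
  qed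
  show ?thesis
    unfolding bernardi_action_def act
  proof (rule the_equality)
    fix T'' assume T'': "spanning_tree D a r T'' \<and> bernardi D a r q T'' = bernardi D a r q T'"
    then have "bernardi D a r q T'' x = bernardi D a r q T' x" for x by simp
    then have "heads (bern_orient q T'') x = heads (bern_orient q T') x" for x
      using bernardi_eq_heads[of T'' q x] bernardi_eq_heads[OF T' q, of x] T'' q by simp
    then show "T'' = T'" using bern_orient_inj T'' T' q by blast
  qed (use T' in simp)
qed

subsection \<open>Change of the starting dart\<close>

context
  fixes T q q2
  assumes T: "spanning_tree D a r T" and q: "q \<in> D" and q2: "q2 \<in> D"
begin

lemma fv_rebase_ge:
  assumes "h \<in> D" "fv T q q2 \<le> fv T q h"
  shows "fv T q h = fv T q q2 + fv T q2 h"
  using assms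
proof (induction "fv T q h" arbitrary: h rule: less_induct)
  case (less h)
  show ?case
  proof (cases "h = q2")
    case True
    then show ?thesis using fv_start[OF T] by simp
  next
    case False
    then have lt: "fv T q q2 < fv T q h"
      using less.prems fv_eq_iff[OF T q q2 less.prems(1)] by auto
    then have "h \<noteq> q" using fv_start[OF T, of q] by auto
    then obtain p where p: "p \<in> D" "h = tour_step a r T p" "fv T q h = Suc (fv T q p)"
      using fv_pred[OF T q less.prems(1)] by blast
    have "fv T q p = fv T q q2 + fv T q2 p"
      using less.hyps[OF _ p(1)] p(3) lt by simp
    moreover have "fv T q2 h = Suc (fv T q2 p)"
      using fv_step[OF T q2 p(1)] p(2) False by simp
    ultimately show ?thesis using p(3) by simp
  qed
qed

lemma fv_rebase_less:
  assumes "h \<in> D" "fv T q h < fv T q q2"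
  shows "fv T q2 h = fv T q h + fv T q2 q"
  using assms
proof (induction "fv T q h" arbitrary: h rule: less_induct)
  case (less h)
  show ?case
  proof (cases "h = q")
    case True
    then show ?thesis using fv_start[OF T] by simp
  next
    case False
    then obtain p where p: "p \<in> D" "h = tour_step a r T p" "fv T q h = Suc (fv T q p)"
      using fv_pred[OF T q less.prems(1)] by blast
    have "fv T q2 p = fv T q p + fv T q2 q"
      using less.hyps[OF _ p(1)] p(3) less.prems by simp
    moreover have "h \<noteq> q2" using less.prems by auto
    then have "fv T q2 h = Suc (fv T q2 p)"
      using fv_step[OF T q2 p(1)] p(2) by simp
    ultimately show ?thesis using p(3) by simp
  qed
qed

end

text \<open>The tour from \<open>q2\<close> is a rotation of the tour from \<open>q\<close>: the
  darts from \<open>q2\<close> onwards come first, then the earlier ones, each group in its old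
  order.\<close>

lemma fv_rebase:
  assumes T: "spanning_tree D a r T" and q: "q \<in> D" and q2: "q2 \<in> D" and h: "h \<in> D" and k: "k \<in> D"
  shows "fv T q2 h < fv T q2 k \<longleftrightarrow>
    (if fv T q h < fv T q q2 \<longleftrightarrow> fv T q k < fv T q q2 then fv T q h < fv T q k else fv T q q2 \<le> fv T q h)"
proof -
  note ge = fv_rebase_ge[OF T q q2] and less = fv_rebase_less[OF T q q2]
  note ge' = fv_rebase_ge[OF T q2 q]
  have late: "fv T q2 u < fv T q2 w" if "u \<in> D" "w \<in> D" "fv T q q2 \<le> fv T q u" "fv T q w < fv T q q2" for u w
    using ge[OF that(1,3)] less[OF that(2,4)] ge'[OF that(1)] that(4) by linarith
  show ?thesis
    using ge[OF h] ge[OF k] less[OF h] less[OF k] late[OF h k] late[OF k h] by auto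
qed

lemma bernardi_alt:
  "bernardi D a r q T x = (\<Sum>h\<in>D. of_bool (h \<notin> T \<and> fv T q h < fv T q (a h)) * of_bool (vert r h = x))"
proof -
  have "bernardi D a r q T x = (\<Sum>h\<in>D. of_bool (h \<notin> T \<and> fv T q h < fv T q (a h) \<and> vert r h = x))"
    unfolding bernardi_def by (simp add: Int_def conj_ac)
  also have "\<dots> = (\<Sum>h\<in>D. of_bool (h \<notin> T \<and> fv T q h < fv T q (a h)) * of_bool (vert r h = x))"
    by (rule sum.cong) auto
  finally show ?thesis .
qed

lemma tour_step_neq:
  assumes T: "spanning_tree D a r T" and q: "q \<in> D"
  shows "tour_step a r T q \<noteq> q"
proof
  assume "tour_step a r T q = q"
  then have "{q} = D" using q by (intro tour_single_orbit[OF T]) auto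
  then show False using a_in[OF q] a_neq[OF q] by auto
qed

text \<open>If \<open>q\<close> is cut, it merely moves to the end of the tour, and its edge is now
  cut from the other side. If \<open>q\<close> is a tree dart, the block beyond \<open>q\<close>
  moves to the end, so each non-tree edge across the cut is now cut from outside. With the
  correction for the edge of \<open>q\<close>, this is the Laplacian of minus the indicator of that
  side. The correction is the same for all \<open>T\<close>, so it cancels in differences.\<close>

lemma bernardi_rebase_vertex:
  assumes T: "spanning_tree D a r T" and q: "q \<in> D"
  shows "principal (\<lambda>x. bernardi D a r (r q) T x - bernardi D a r q T x
    - of_bool (vert r (a q) = x) + of_bool (vert r q = x))"
proof -
  define \<delta> :: "'d \<Rightarrow> int" where "\<delta> h = of_bool (h \<notin> T \<and> fv T (r q) h < fv T (r q) (a h))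
    - of_bool (h \<notin> T \<and> fv T q h < fv T q (a h)) - of_bool (h = a q) + of_bool (h = q)" for h
  define f :: "'d set \<Rightarrow> int" where "f x = - of_bool (q \<in> T \<and> x \<in> tree_side T q)" for x
  have point: "of_bool (vert r k = x) = (\<Sum>h\<in>D. of_bool (h = k) * of_bool (vert r h = x) :: int)"
    if "k \<in> D" for k x
    using that by (simp add: of_bool_def if_distrib[of "\<lambda>u. u * _"] sum.delta cong: if_cong)
  have E: "bernardi D a r (r q) T x - bernardi D a r q T x - of_bool (vert r (a q) = x) + of_bool (vert r q = x)
      = (\<Sum>h\<in>D. \<delta> h * of_bool (vert r h = x))" for x
    unfolding \<delta>_def bernardi_alt point[OF q] point[OF a_in[OF q]]
    by (simp add: left_diff_distrib distrib_right sum_subtractf sum.distrib)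
  have delta: "\<delta> h = f (vert r h) - f (vert r (a h))" if h: "h \<in> D" for h
  proof (cases "q \<in> T")
    case False
    then have "tour_step a r T q = r q" unfolding tour_step_def by simp
    then have m: "fv T q (r q) = 1"
      using fv_step[OF T q q] tour_step_neq[OF T q] fv_start[OF T, of q] by simp
    have zero: "fv T q k < 1 \<longleftrightarrow> k = q" if "k \<in> D" for k
      using fv_eq_iff[OF T q that q] fv_start[OF T, of q] by auto
    have "a h = q \<longleftrightarrow> h = a q" using a_a[OF h] a_a[OF q] by auto
    moreover have "a q \<notin> T" using False TD(5)[OF T q] by simp
    moreover have "fv T q q < fv T q (a q)"
      using zero[of "a q"] q fv_start[OF T, of q] by simp
    ultimately show ?thesis
      using fv_rebase[OF T q r_in[OF q] h a_in[OF h]] fv_total[OF T q h] zero[OF h] zero[OF a_in[OF h]] h q False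
      unfolding \<delta>_def f_def m by (cases "h = q"; cases "h = a q") auto
  next
    case True
    let ?A = "tree_side T q"
    note cut = tree_cut_tree_side[OF T True]
    have A: "vert r q \<notin> ?A" "vert r (a q) \<in> ?A" using cut unfolding tree_cut_def by auto
    note interval = tree_cut_interval[OF T q A(1) cut]
    have step: "tour_step a r T (a q) = r q"
      using True TD(2)[OF T True] q unfolding tour_step_def by simp
    show ?thesis
    proof (cases "h \<in> T")
      case in_T: True
      have "h = q \<or> h = a q \<or> (vert r h \<in> ?A \<longleftrightarrow> vert r (a h) \<in> ?A)"
        using cut in_T unfolding tree_cut_def by blast
      then show ?thesis
        using in_T A True q unfolding \<delta>_def f_def by auto
    next
      case out_T: False
      have neq: "h \<noteq> q" "h \<noteq> a q" "a h \<noteq> q"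
        using out_T True TD(2)[OF T True] TD(5)[OF T h] by auto
      have pos: "0 < fv T q k" if "k \<in> D" "k \<noteq> q" for k
        using fv_eq_iff[OF T q that(1) q] that fv_start[OF T, of q] by simp
      have side: "vert r k \<in> ?A \<longleftrightarrow> fv T q k \<le> fv T q (a q)" if "k \<in> D" "k \<noteq> q" for k
        using interval[OF that(1)] pos[OF that] fv_start[OF T, of q] by simp
      show ?thesis
      proof (cases "r q = q")
        case True
        \<comment> \<open>With \<open>r q = q\<close> the tour closes up right after
          \<open>a q\<close>, so all darts other than \<open>q\<close> lie beyond \<open>q\<close>
          and no non-tree edge crosses the cut.\<close>
        have all: "fv T q k \<le> fv T q (a q)" if "k \<in> D" for k
        proof (rule ccontr)
          assume "\<not> ?thesis"
          then have "fv T q ((tour_step a r T ^^ Suc (fv T q (a q))) q) = Suc (fv T q (a q))"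
            by (intro fv_funpow[OF T q that]) simp
          moreover have "(tour_step a r T ^^ Suc (fv T q (a q))) q = q"
            using tour_fv[OF T q a_in[OF q]] step True by simp
          ultimately show False using fv_start[OF T, of q] by simp
        qed
        show ?thesis
          using all[OF h] all[OF a_in[OF h]] side[OF h] side[OF a_in[OF h]] neq
          unfolding \<delta>_def f_def True by simp
      next
        case False
        then have m: "fv T q (r q) = Suc (fv T q (a q))"
          using fv_step[OF T q a_in[OF q]] step by simp
        have low: "fv T q k < fv T q (r q) \<longleftrightarrow> vert r k \<in> ?A" if "k \<in> D" "k \<noteq> q" for k
          using side[OF that] unfolding m by auto
        show ?thesis
          using fv_rebase[OF T q r_in[OF q] h a_in[OF h]] side[OF h neq(1)] side[OF a_in[OF h] neq(3)]
            low[OF h neq(1)] low[OF a_in[OF h] neq(3)] neq h \<open>q \<in> T\<close> out_T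
          unfolding \<delta>_def f_def by auto
      qed
    qed
  qed
  show ?thesis
    by (rule principalI[OF E delta])
qed

end

subsection \<open>Planar duality\<close>

context ribbon_map
begin

lemma telescope:
  fixes g :: "'d \<Rightarrow> int"
  shows "(\<Sum>h\<in>D. of_bool (vert r h = x) * (g (r h) - g h)) = 0"
proof -
  have "bij_betw r D D" using ribbon unfolding ribbon_graph_def by blast
  from sum.reindex_bij_betw[OF this, of "\<lambda>h. of_bool (vert r h = x) * g h"]
  have "(\<Sum>h\<in>D. of_bool (vert r h = x) * g (r h)) = (\<Sum>h\<in>D. of_bool (vert r h = x) * g h)"
    by simp
  then show ?thesis by (simp add: right_diff_distrib sum_subtractf)
qed

lemma ribbon_map_dual: "ribbon_map D a (r \<circ> a)"
  using ribbon unfolding ribbon_map_def ribbon_graph_def by (auto intro: bij_betw_trans)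

lemma card_D: "card D = 2 * card (edges a D)"
proof -
  have union: "\<Union> (edges a D) = D"
    unfolding edges_def edge_of_def by auto
  have "2 * card (edges a D) = card (\<Union> (edges a D))"
  proof (rule card_partition)
    show "finite (edges a D)" unfolding edges_def by simp
    show "finite (\<Union> (edges a D))" unfolding union by simp
    fix e assume "e \<in> edges a D"
    then show "card e = 2" unfolding edges_def edge_of_def by auto
  next
    have edge_eq: "e = {x, a x}" if "e \<in> edges a D" "x \<in> e" for e x
      using that unfolding edges_def edge_of_def by auto
    fix e e' assume "e \<in> edges a D" "e' \<in> edges a D" "e \<noteq> e'"
    then show "e \<inter> e' = {}"
      using edge_eq by (metis disjoint_iff)
  qed
  then show ?thesis unfolding union by simp
qed

lemma boundary_alt:
  "boundary D a r c x = (\<Sum>h\<in>D. of_bool (vert r h = x) * (c (a h) - c h))"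
proof -
  have "(\<Sum>h\<in>D. c h * of_bool (vert r (a h) = x)) = (\<Sum>h\<in>D. c (a h) * of_bool (vert r h = x))"
    by (rule sum.reindex_bij_witness[of _ a a]) auto
  then show ?thesis
    unfolding boundary_def of_bool_def[symmetric]
    by (simp add: right_diff_distrib sum_subtractf mult.commute)
qed

lemma boundary_diff: "boundary D a r (\<lambda>h. c h - c' h) x = boundary D a r c x - boundary D a r c' x"
  unfolding boundary_def by (simp add: left_diff_distrib sum_subtractf)

end

context connected_map
begin

lemma heads_diff_boundary:
  assumes X: "orientation X" and Y: "orientation Y"
  shows "heads Y x - heads X x = boundary D a r (\<lambda>h. of_bool (h \<in> Y - X)) x"
proof -
  have "heads Y x - heads X x = (\<Sum>h\<in>Y - X. of_bool (vert r (a h) = x) - of_bool (vert r h = x))"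
    using sum_flip[OF Y X, of "\<lambda>y. of_bool (y = x)"] unfolding heads_def by simp
  also have "\<dots> = (\<Sum>h\<in>D. of_bool (h \<in> Y - X) * (of_bool (vert r (a h) = x) - of_bool (vert r h = x)))"
    by (rule sum_subset_of_bool) (use orientationD(1)[OF Y] in blast)
  finally show ?thesis unfolding boundary_def of_bool_def .
qed

lemma bernardi_diff_boundary:
  assumes T: "spanning_tree D a r T" and T': "spanning_tree D a r T'" and q: "q \<in> D"
  shows "bernardi D a r q T' x - bernardi D a r q T x
    = boundary D a r (\<lambda>h. of_bool (h \<in> bern_orient q T' - bern_orient q T)) x"
  using heads_diff_boundary[OF orientation_bern_orient[OF T q] orientation_bern_orient[OF T' q]]
    bernardi_eq_heads[OF T q] bernardi_eq_heads[OF T' q] by simp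

text \<open>The net flow of a cycle across the fundamental cut of \<open>y\<close> vanishes, and
  \<open>y\<close> is the only edge there that can carry flow. Summing over darts counts it twice,
  hence the factor in \<open>- 2 * z y\<close>.\<close>

lemma tree_supported_cycle:
  assumes T: "spanning_tree D a r T" and y: "y \<in> T"
    and anti: "\<And>h. h \<in> D \<Longrightarrow> z (a h) = - z h" and supp: "\<And>h. h \<in> D \<Longrightarrow> h \<notin> T \<Longrightarrow> z h = (0::int)"
    and cycle: "\<And>x. (\<Sum>h\<in>D. of_bool (vert r h = x) * z h) = 0"
  shows "z y = 0"
proof -
  let ?A = "tree_side T y"
  note cut = tree_cut_tree_side[OF T y]
  have "y \<in> D" using TD(4)[OF T y] .
  have one: "(\<Sum>h\<in>D. of_bool (vert r h \<in> ?A) * z h) = 0"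
  proof -
    have "(\<Sum>h\<in>D. of_bool (vert r h \<in> ?A) * z h)
        = (\<Sum>x\<in>verts D r. \<Sum>h\<in>{h \<in> D. vert r h = x}. of_bool (vert r h \<in> ?A) * z h)"
      by (rule sum.group[symmetric]) auto
    also have "\<dots> = (\<Sum>x\<in>verts D r. of_bool (x \<in> ?A) * (\<Sum>h\<in>D. of_bool (vert r h = x) * z h))"
    proof (rule sum.cong[OF refl])
      fix x
      have "(\<Sum>h\<in>{h \<in> D. vert r h = x}. of_bool (vert r h \<in> ?A) * z h)
          = (\<Sum>h\<in>D. of_bool (x \<in> ?A) * (of_bool (vert r h = x) * z h))"
        by (rule sum.mono_neutral_cong_left) auto
      then show "(\<Sum>h\<in>{h \<in> D. vert r h = x}. of_bool (vert r h \<in> ?A) * z h)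
          = of_bool (x \<in> ?A) * (\<Sum>h\<in>D. of_bool (vert r h = x) * z h)"
        unfolding sum_distrib_left .
    qed
    finally show ?thesis unfolding cycle by simp
  qed
  have "(\<Sum>h\<in>D. of_bool (vert r (a h) \<in> ?A) * z (a h)) = 0"
    using sum_a[of "\<lambda>h. of_bool (vert r h \<in> ?A) * z h"] one by simp
  moreover have "(\<Sum>h\<in>D. of_bool (vert r (a h) \<in> ?A) * z (a h)) = (\<Sum>h\<in>D. - (of_bool (vert r (a h) \<in> ?A) * z h))"
    by (rule sum.cong) (use anti in auto)
  ultimately have "0 = (\<Sum>h\<in>D. of_bool (vert r h \<in> ?A) * z h) + (\<Sum>h\<in>D. - (of_bool (vert r (a h) \<in> ?A) * z h))"
    using one by simp
  also have "\<dots> = (\<Sum>h\<in>D. (of_bool (vert r h \<in> ?A) - of_bool (vert r (a h) \<in> ?A)) * z h)"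
    unfolding sum.distrib[symmetric] by (rule sum.cong) (auto simp: left_diff_distrib)
  also have "\<dots> = (\<Sum>h\<in>{y, a y}. (of_bool (vert r h \<in> ?A) - of_bool (vert r (a h) \<in> ?A)) * z h)"
  proof (rule sum.mono_neutral_right)
    show "\<forall>h\<in>D - {y, a y}. (of_bool (vert r h \<in> ?A) - of_bool (vert r (a h) \<in> ?A)) * z h = 0"
    proof
      fix h assume h: "h \<in> D - {y, a y}"
      show "(of_bool (vert r h \<in> ?A) - of_bool (vert r (a h) \<in> ?A)) * z h = 0"
      proof (cases "h \<in> T")
        case True
        then have "vert r h \<in> ?A \<longleftrightarrow> vert r (a h) \<in> ?A"
          using cut h unfolding tree_cut_def by blast
        then show ?thesis by simp
      qed (use supp h in simp)
    qed
  qed (use \<open>y \<in> D\<close> in auto)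
  also have "\<dots> = - 2 * z y"
    using cut \<open>y \<in> D\<close> anti[OF \<open>y \<in> D\<close>] unfolding tree_cut_def by simp
  finally show ?thesis by simp
qed

lemma tree_potential:
  assumes T: "spanning_tree D a r T" and q: "q \<in> D" and anti: "\<And>h. h \<in> D \<Longrightarrow> z (a h) = - z h"
  obtains p :: "'d set \<Rightarrow> int" where "\<And>h. h \<in> T \<Longrightarrow> z h = p (vert r h) - p (vert r (a h))"
proof
  let ?p = "potential T q (\<lambda>h. - z h)"
  fix h assume h: "h \<in> T"
  have "h \<in> D" using TD(4)[OF T h] .
  show "z h = ?p (vert r h) - ?p (vert r (a h))"
  proof (cases "fv T q h < fv T q (a h)")
    case True
    then show ?thesis using potential_diff[OF T q, of h "\<lambda>h. - z h"] h by simp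
  next
    case False
    then have "a h \<in> arcs T q"
      using fv_total[OF T q \<open>h \<in> D\<close>] TD(2)[OF T h] \<open>h \<in> D\<close> by simp
    then show ?thesis
      using potential_diff[OF T q, of "a h" "\<lambda>h. - z h"] anti \<open>h \<in> D\<close> by simp
  qed
qed

text \<open>Walking along a tree edge keeps the tour on the same face, and cutting through crosses a
  dual edge outside \<open>T\<close>. The tour meets all darts, so it joins all faces.\<close>

lemma dual_tree_connected:
  assumes T: "spanning_tree D a r T"
  shows "connected_via D a (r \<circ> a) (D - T)"
  unfolding connected_via_def
proof (intro ballI)
  interpret dual: ribbon_map D a "r \<circ> a" by (rule ribbon_map_dual)
  let ?s = "r \<circ> a" and ?L = "link a (r \<circ> a) (D - T)"
  have step: "(vert ?s h, vert ?s (tour_step a r T h)) \<in> ?L\<^sup>*" if h: "h \<in> D" for h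
  proof (cases "h \<in> T")
    case True
    then have "tour_step a r T h = ?s h" unfolding tour_step_def by simp
    then show ?thesis using dual.vert_r[OF h] by simp
  next
    case False
    then have "tour_step a r T h = ?s (a h)" using h unfolding tour_step_def by simp
    then have "vert ?s (tour_step a r T h) = vert ?s (a h)" using dual.vert_r[OF a_in[OF h]] by simp
    then have "(vert ?s h, vert ?s (tour_step a r T h)) \<in> ?L"
      using False h unfolding link_def by auto
    then show ?thesis by blast
  qed
  fix h k assume h: "h \<in> D" and k: "k \<in> D"
  have "(vert ?s h, vert ?s ((tour_step a r T ^^ n) h)) \<in> ?L\<^sup>*" for n
  proof (induction n)
    case (Suc n)
    show ?case
      unfolding funpow.simps comp_apply[of "tour_step a r T"]
      by (rule rtrancl_trans[OF Suc step[OF tour_in[OF T h]]])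
  qed simp
  then show "(vert ?s h, vert ?s k) \<in> ?L\<^sup>*"
    using tour_reaches[OF T h k] by metis
qed

lemma connected_map_dual: "connected_map D a (r \<circ> a)"
proof -
  obtain T where T: "spanning_tree D a r T"
    using connected_contains_tree[of D] connected by auto
  have "link a (r \<circ> a) (D - T) \<subseteq> link a (r \<circ> a) D" unfolding link_def by blast
  then have "(link a (r \<circ> a) (D - T))\<^sup>* \<subseteq> (link a (r \<circ> a) D)\<^sup>*" by (rule rtrancl_mono)
  then have "connected_via D a (r \<circ> a) D"
    using dual_tree_connected[OF T] unfolding connected_via_def by blast
  then show ?thesis
    using ribbon_map_dual unfolding connected_map_def connected_map_axioms_def by blast
qed

text \<open>Walking in the dual applies \<open>r \<circ> a\<close> after \<open>a\<close>, which is
  \<open>r\<close>, and cutting applies \<open>r \<circ> a\<close>; complementing the tree exchanges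
  the two cases back.\<close>

lemma tour_step_dual: "h \<in> D \<Longrightarrow> tour_step a (r \<circ> a) (D - T) h = tour_step a r T h"
  unfolding tour_step_def by simp

lemma first_visit_dual:
  assumes T: "spanning_tree D a r T" and q: "q \<in> D"
  shows "first_visit a (r \<circ> a) (D - T) q h = fv T q h"
proof -
  have "(tour_step a (r \<circ> a) (D - T) ^^ n) q = (tour_step a r T ^^ n) q" for n
  proof (induction n)
    case (Suc n)
    show ?case
      unfolding funpow.simps comp_apply[of "tour_step _ _ _"] Suc
      by (rule tour_step_dual[OF tour_in[OF T q]])
  qed simp
  then show ?thesis unfolding first_visit_def by simp
qed

end

section \<open>Dual trees, Psi and the comparison of the two actions\<close>

locale planar_map = connected_map D a r
  for D :: "'d set" and a r :: "'d \<Rightarrow> 'd" +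
  assumes euler: "card (verts D r) + card (verts D (r \<circ> a)) = card (edges a D) + 2"
begin

interpretation dual: connected_map D a "r \<circ> a"
  by (rule connected_map_dual)

text \<open>The complement is connected in the dual and has the size of a tree: with both darts
  counted, 2E - 2(V - 1) = 2(F - 1) by Euler's formula.\<close>

lemma dual_spanning_tree:
  assumes T: "spanning_tree D a r T" and q: "q \<in> D"
  shows "spanning_tree D a (r \<circ> a) (D - T)"
proof (rule dual.spanning_tree_if_card)
  show "connected_via D a (r \<circ> a) (D - T)" by (rule dual_tree_connected[OF T])
  show "h \<in> D - T \<Longrightarrow> a h \<in> D - T" for h using TD(5)[OF T] by auto
  have "1 \<le> card (verts D r)"
    using vert_in_verts[OF q] card_gt_0_iff[of "verts D r"] by force
  moreover have "1 \<le> card (verts D (r \<circ> a))"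
    using dual.vert_in_verts[OF q] card_gt_0_iff[of "verts D (r \<circ> a)"] by force
  ultimately show "card (D - T) = 2 * (card (verts D (r \<circ> a)) - 1)"
    using card_Diff_subset[OF finite_subset[OF TD(1)[OF T] finite_D] TD(1)[OF T]]
      card_D card_spanning_tree[OF T q] euler by simp
qed (use q in auto)

lemma dual_bern_orient:
  assumes T: "spanning_tree D a r T" and q: "q \<in> D" and h: "h \<in> D"
  shows "h \<in> dual.bern_orient q (D - T) \<longleftrightarrow> a h \<in> bern_orient q T"
  using dual.in_bern_orient[OF dual_spanning_tree[OF T q] q h] in_bern_orient[OF T q a_in[OF h]]
    first_visit_dual[OF T q] fv_total[OF T q h] TD(5)[OF T h] h by auto

text \<open>Reversing the same edges carries the Bernardi orientation of one tree to that of another,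
in the graph and in its dual; hence both differences are boundaries of corresponding chains.\<close>

lemma dual_bernardi_diff:
  assumes T: "spanning_tree D a r T" and T': "spanning_tree D a r T'" and q: "q \<in> D"
  shows "bernardi D a (r \<circ> a) q (D - T') x - bernardi D a (r \<circ> a) q (D - T) x
    = boundary D a (r \<circ> a) (dual_chain a (\<lambda>h. of_bool (h \<in> bern_orient q T' - bern_orient q T))) x"
proof -
  have "bernardi D a (r \<circ> a) q (D - T') x - bernardi D a (r \<circ> a) q (D - T) x
    = boundary D a (r \<circ> a) (\<lambda>h. of_bool (h \<in> dual.bern_orient q (D - T') - dual.bern_orient q (D - T))) x"
    by (rule dual.bernardi_diff_boundary[OF dual_spanning_tree[OF T q] dual_spanning_tree[OF T' q] q])
  also have "\<dots> = boundary D a (r \<circ> a) (dual_chain a (\<lambda>h. of_bool (h \<in> bern_orient q T' - bern_orient q T))) x"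
    unfolding boundary_def
    by (rule sum.cong) (use dual_bern_orient T T' q in \<open>simp_all add: dual_chain_def\<close>)
  finally show ?thesis .
qed

text \<open>The cycle space is spanned by the faces: subtract from a cycle the coboundary of a potential
on the dual tree; what remains is a cycle supported on a tree.\<close>

lemma cycle_is_dual_gradient:
  fixes z :: "'d \<Rightarrow> int"
  assumes T: "spanning_tree D a r T" and q: "q \<in> D" and anti: "\<And>h. h \<in> D \<Longrightarrow> z (a h) = - z h"
    and cycle: "\<And>x. (\<Sum>h\<in>D. of_bool (vert r h = x) * z h) = 0"
  obtains p where "\<And>h. h \<in> D \<Longrightarrow> z h = p (vert (r \<circ> a) h) - p (vert (r \<circ> a) (a h))"
proof -
  let ?face = "vert (r \<circ> a)"
  obtain p where p: "\<And>h. h \<in> D - T \<Longrightarrow> z h = p (?face h) - p (?face (a h))"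
    using dual.tree_potential[OF dual_spanning_tree[OF T q] q, of z] anti by blast
  define w where "w h = z h - (p (?face h) - p (?face (a h)))" for h
  \<comment> \<open>Since \<open>r \<circ> a\<close> sends \<open>a h\<close> to \<open>r h\<close>,
    the gradient of a function on faces telescopes around each vertex: it is itself a cycle.\<close>
  have face_r: "?face (a h) = ?face (r h)" if "h \<in> D" for h
    using dual.vert_r[OF a_in[OF that]] that by simp
  have cycle_w: "(\<Sum>h\<in>D. of_bool (vert r h = x) * w h) = 0" for x
  proof -
    have "(\<Sum>h\<in>D. of_bool (vert r h = x) * w h)
        = (\<Sum>h\<in>D. of_bool (vert r h = x) * z h) + (\<Sum>h\<in>D. of_bool (vert r h = x) * (p (?face (r h)) - p (?face h)))"
      unfolding sum.distrib[symmetric] w_def by (rule sum.cong) (auto simp: face_r)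
    then show ?thesis using cycle telescope[of x "\<lambda>h. p (?face h)"] by simp
  qed
  have zero_T: "w h = 0" if "h \<in> T" for h
  proof (rule tree_supported_cycle[OF T that, of w])
    show "w (a k) = - w k" if "k \<in> D" for k
      unfolding w_def a_a[OF that] anti[OF that] by simp
    show "w k = 0" if "k \<in> D" "k \<notin> T" for k
      using p[of k] that unfolding w_def by simp
  qed (rule cycle_w)
  have "z h = p (?face h) - p (?face (a h))" if "h \<in> D" for h
    using zero_T[of h] p[of h] that unfolding w_def by (cases "h \<in> T") simp_all
  then show thesis by (rule that)
qed

text \<open>Well-definedness of Psi. The antisymmetrised chain, corrected by the gradient of
  \<open>f\<close>, is a cycle and hence the gradient of some \<open>p\<close> on faces. In the dual
  boundary the \<open>f\<close> terms telescope around each face, leaving the Laplacian of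
  \<open>p\<close>.\<close>

lemma principal_dual:
  assumes prin: "principal (boundary D a r c)" and q: "q \<in> D"
  shows "dual.principal (boundary D a (r \<circ> a) (dual_chain a c))"
proof -
  obtain f where f: "\<And>x. boundary D a r c x = laplacian D a r f x"
    using prin unfolding principal_def by blast
  obtain T where T: "spanning_tree D a r T"
    using connected_contains_tree[of D] connected by auto
  define z where "z h = c h - c (a h) - f (vert r (a h)) + f (vert r h)" for h
  have "(\<Sum>h\<in>D. of_bool (vert r h = x) * z h) = laplacian D a r f x - boundary D a r c x" for x
    unfolding laplacian_alt boundary_alt sum_subtractf[symmetric] z_def
    by (rule sum.cong) (auto simp: algebra_simps)
  then have cycle: "(\<Sum>h\<in>D. of_bool (vert r h = x) * z h) = 0" for x
    using f by simp
  obtain p where p: "\<And>h. h \<in> D \<Longrightarrow> z h = p (vert (r \<circ> a) h) - p (vert (r \<circ> a) (a h))"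
    using cycle_is_dual_gradient[OF T q _ cycle] unfolding z_def by auto
  show ?thesis
  proof (rule dual.principalI)
    fix h assume "h \<in> D"
    then show "z h = p (vert (r \<circ> a) h) - p (vert (r \<circ> a) (a h))" by (rule p)
  next
    fix x
    let ?e = "\<lambda>h. of_bool (vert (r \<circ> a) h = x) :: int"
    have "boundary D a (r \<circ> a) (dual_chain a c) x
        = (\<Sum>h\<in>D. z h * ?e h) + (\<Sum>h\<in>D. ?e h * (f (vert r ((r \<circ> a) h)) - f (vert r h)))"
      unfolding dual.boundary_alt sum.distrib[symmetric] dual_chain_def z_def
      by (rule sum.cong) (auto simp: algebra_simps)
    then show "boundary D a (r \<circ> a) (dual_chain a c) x = (\<Sum>h\<in>D. z h * ?e h)"
      using dual.telescope[of x "\<lambda>h. f (vert r h)"] by simp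
  qed
qed

lemma dual_chain_diff: "dual_chain a (\<lambda>h. c h - c' h) = (\<lambda>h. dual_chain a c h - dual_chain a c' h)"
  unfolding dual_chain_def by auto

lemma principal_diff_dual:
  assumes "principal (\<lambda>x. boundary D a r c x - boundary D a r c' x)" and "q \<in> D"
  shows "dual.principal (\<lambda>x. boundary D a (r \<circ> a) (dual_chain a c) x - boundary D a (r \<circ> a) (dual_chain a c') x)"
proof -
  have "boundary D a r (\<lambda>h. c h - c' h) = (\<lambda>x. boundary D a r c x - boundary D a r c' x)"
    using boundary_diff by auto
  then have "dual.principal (boundary D a (r \<circ> a) (dual_chain a (\<lambda>h. c h - c' h)))"
    using assms by (intro principal_dual) auto
  moreover have "boundary D a (r \<circ> a) (dual_chain a (\<lambda>h. c h - c' h))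
      = (\<lambda>x. boundary D a (r \<circ> a) (dual_chain a c) x - boundary D a (r \<circ> a) (dual_chain a c') x)"
    unfolding dual_chain_diff using dual.boundary_diff by auto
  ultimately show ?thesis by simp
qed

text \<open>\<open>W\<close> collects the dual starting darts for which the claim holds. It contains
  \<open>q\<close>, where both differences come from the same chain. Closure under \<open>r\<close>
  is the vertex move in the graph carried over by \<open>principal_diff_dual\<close>; closure under
  \<open>?s\<close> is the vertex move of the dual.\<close>

lemma dual_bernardi_equivalent:
  assumes T: "spanning_tree D a r T" and T': "spanning_tree D a r T'" and q: "q \<in> D" and q': "q' \<in> D"
    and prin: "principal (\<lambda>x. bernardi D a r q T' x - bernardi D a r q T x - boundary D a r c x)"
  shows "dual.principal (\<lambda>x. bernardi D a (r \<circ> a) q' (D - T') x - bernardi D a (r \<circ> a) q' (D - T) x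
    - boundary D a (r \<circ> a) (dual_chain a c) x)"
proof -
  let ?s = "r \<circ> a"
  define e where "e k h = (of_bool (h \<in> bern_orient k T' - bern_orient k T) :: int)" for k h
  define G where "G k x = bernardi D a ?s k (D - T') x - bernardi D a ?s k (D - T) x" for k x
  let ?dc = "boundary D a ?s (dual_chain a c)"
  have diff: "bernardi D a r k T' x - bernardi D a r k T x = boundary D a r (e k) x" if "k \<in> D" for k x
    using bernardi_diff_boundary[OF T T' that] unfolding e_def .
  have G: "G k = boundary D a ?s (dual_chain a (e k))" if "k \<in> D" for k
    using dual_bernardi_diff[OF T T' that] unfolding G_def e_def by auto
  define W where "W = {k \<in> D. dual.principal (\<lambda>x. G k x - ?dc x)}"
  have move: "l \<in> W" if "k \<in> W" "l \<in> D" "dual.principal (\<lambda>x. G l x - G k x)" for k l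
    using that dual.principal_add[of "\<lambda>x. G k x - ?dc x" "\<lambda>x. G l x - G k x"] unfolding W_def by simp
  have "q \<in> W"
    using principal_diff_dual[of "e q" c q] prin q G[OF q] diff[OF q] unfolding W_def by simp
  have r: "r k \<in> W" if k: "k \<in> W" for k
  proof -
    have "k \<in> D" "r k \<in> D" using k unfolding W_def by auto
    have "principal (\<lambda>x. boundary D a r (e (r k)) x - boundary D a r (e k) x)"
      using principal_diff[OF bernardi_rebase_vertex[OF T' \<open>k \<in> D\<close>] bernardi_rebase_vertex[OF T \<open>k \<in> D\<close>]]
      unfolding diff[OF \<open>k \<in> D\<close>, symmetric] diff[OF \<open>r k \<in> D\<close>, symmetric]
      by (simp add: algebra_simps)
    then show ?thesis
      using principal_diff_dual[OF _ q, of "e (r k)" "e k"] G \<open>k \<in> D\<close> \<open>r k \<in> D\<close>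
      by (intro move[OF k]) simp_all
  qed
  have s: "?s k \<in> W" if k: "k \<in> W" for k
  proof -
    have "k \<in> D" using k unfolding W_def by auto
    have "dual.principal (\<lambda>x. G (?s k) x - G k x)"
      using dual.principal_diff[OF
          dual.bernardi_rebase_vertex[OF dual_spanning_tree[OF T' q] \<open>k \<in> D\<close>]
          dual.bernardi_rebase_vertex[OF dual_spanning_tree[OF T q] \<open>k \<in> D\<close>]]
      unfolding G_def by (simp add: algebra_simps)
    then show ?thesis
      using \<open>k \<in> D\<close> by (intro move[OF k]) simp_all
  qed
  \<comment> \<open>\<open>?s k\<close> is \<open>r (a k)\<close>, which lies on the
    \<open>r\<close>-orbit of \<open>a k\<close>, so the two closures together give closure under
    \<open>a\<close>.\<close>
  have "a k \<in> W" if k: "k \<in> W" for k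
  proof -
    have "a k \<in> D" using k unfolding W_def by simp
    then show ?thesis
      using vert_closed[of W "r (a k)" "a k"] r s[OF k] by simp
  qed
  then have "W = D"
    using r \<open>q \<in> W\<close> connected by (intro closed_eq_D[of D W q]) (auto simp: W_def)
  then show ?thesis using q' unfolding W_def G_def by auto
qed

lemma sigma_bernardi_action:
  assumes T: "spanning_tree D a r T" and q: "q \<in> D" and q': "q' \<in> D"
  shows "sigma D (bernardi_action D a r q (boundary D a r c) T)
    = bernardi_action D a (r \<circ> a) q' (boundary D a (r \<circ> a) (dual_chain a c)) (sigma D T)"
proof -
  obtain T' where T': "spanning_tree D a r T'"
    and prin: "principal (\<lambda>x. bernardi D a r q T' x - bernardi D a r q T x - boundary D a r c x)"
    using bernardi_exists[OF T q] by blast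
  have "bernardi_action D a r q (boundary D a r c) T = T'"
    by (rule bernardi_action_eqI[OF T T' q prin])
  moreover have "bernardi_action D a (r \<circ> a) q' (boundary D a (r \<circ> a) (dual_chain a c)) (D - T) = D - T'"
    by (rule dual.bernardi_action_eqI[OF dual_spanning_tree[OF T q] dual_spanning_tree[OF T' q] q'])
      (rule dual_bernardi_equivalent[OF T T' q q' prin])
  ultimately show ?thesis unfolding sigma_def by simp
qed

end

theorem theorem6p1:
  fixes D :: "'d set" and a r :: "'d \<Rightarrow> 'd" and c :: "'d \<Rightarrow> int"
  assumes "planar_ribbon_graph D a r"
    and "bridgeless D a r"
    and "q \<in> D" and "q' \<in> D"
    and "spanning_tree D a r T"
  shows "sigma D (bernardi_action D a r q (boundary D a r c) T)
       = bernardi_action D a (dual_rot a r) q' (boundary D a (dual_rot a r) (dual_chain a c)) (sigma D T)"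
proof -
  interpret planar_map D a r
    by unfold_locales (use assms(1) in \<open>simp_all add: planar_ribbon_graph_def is_graph_def\<close>)
  show ?thesis
    unfolding dual_rot_def by (rule sigma_bernardi_action[OF assms(5,3,4)])
qed

end
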